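(* Let $T$ be a power bounded, complete, model complete o-minimal theory extending the theory of real closed ordered fields, and let $K=(K,\mathcal O,\partial)\models T^{\mathcal O,\partial}$ with differential residue field $\boldsymbol k$. If $\boldsymbol k$ is linearly surjective and $K$ is spherically complete, then $K$ is $T^\partial$-henselian.
   Context: $T$ is a theory in a language $\mathcal L\supseteq\{0,1,+,\cdot,<\}$. Power bounded: for $K\models T$, every $\mathcal L(K)$-definable function $K\to K$ is eventually bounded by a power function, i.e., by an $\mathcal L(K)$-definable endomorphism of the ordered multiplicative group $K^{>}=\{a\in K:a>0\}$. ($\mathcal L(A)$-definable means definable in $\mathcal L$ with parameters from $A$.) A $T$-convex valuation ring of $K\models T$ is a nonempty convex $\mathcal O\subseteq K$ with $F(\mathcal O)\subseteq\mathcal O$ for every $\mathcal L(\emptyset)$-definable continuous $F\colon K\to K$. A $T$-derivation on $K$ is a map $\partial\colon K\to K$, $a\mapsto a'$, such that $F(u)'=\sum_{i=1}^n\frac{\partial F}{\partial Y_i}(u)u_i'$ for every $\mathcal L(\emptyset)$-definable $\mathcal C^1$-function $F\colon U\to K$ with $U\subseteq K^n$ open and every $u\in U$. $T^{\mathcal O,\partial}$ is the theory of $(K,\mathcal O,\partial)$ with $K\models T$, $\mathcal O\neq K$ a $T$-convex valuation ring with maximal ideal $\mathfrak o$, and $\partial$ a $T$-derivation with $\partial\mathfrak o\subseteq\mathfrak o$. Let $v\colon K^\times\to\Gamma$ be the associated valuation, $v(0)=\infty$. Then $\partial\mathcal O\subseteq\mathcal O$, and $\boldsymbol k=\mathcal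 O/\mathfrak o$ carries the induced derivation. $K$ is spherically complete if every nonempty collection of closed balls $\{b:v(b-a)\ge\gamma\}$ ($\gamma\in\Gamma\cup\{\infty\}$), any two of which intersect, has nonempty intersection. For $A=a_0+a_1\partial+\dots+a_s\partial^s\in K[\partial]$ (linear differential operators) put $vA=\min_i va_i$, and for $g\in K$ let $A_{\times g}$ be the operator $y\mapsto A(gy)$. Put $J^r(a)=(a,a',\dots,a^{(r)})$. A function $F\colon K^{1+r}\to K$ is in implicit form if $F=\mathfrak m_F\cdot(Y_r-I_F(Y_0,\dots,Y_{r-1}))$ with $\mathfrak m_F\in K^\times$ and $I_F\colon K^r\to K$ $\mathcal L(K)$-definable. A nonzero $A\in K[\partial]$ linearly approximates $F$ on $B\subseteq K$ if $v\big(F(J^rb)-F(J^ra)-A(b-a)\big)>vA_{\times(b-a)}$ for all distinct $a,b\in B$. $\boldsymbol k$ is linearly surjective if every nonzero operator in $\boldsymbol k[\partial]$ is surjective as a map $\boldsymbol k\to\boldsymbol k$. $K$ is $T^\partial$-henselian if (1) $\boldsymbol k$ is linearly surjective, and (2) for every $r$, every $\mathcal L(K)$-definable $F\colon K^{1+r}\to K$ in implicit form and every nonzero $A\in K[\partial]$ that linearly approximates $F$ on $\mathfrak o$ with $vF(0,\dots,0)>vA$, there is $\epsilon\in\mathfrak o$ with $F(J^r\epsilon)=0$ and $vA_{\times\epsilon}\ge vF(0,\dots,0)$ (where $vA_{\times 0}=\infty$). *)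

theory Defs
  imports "HOL-Computational_Algebra.Polynomial" "HOL-Algebra.QuotRing"
begin

section \<open>First-order languages containing the language of ordered rings\<close>

datatype 'f trm =
    Var nat
  | Zero
  | One
  | Add "'f trm" "'f trm"
  | Mul "'f trm" "'f trm"
  | Fn 'f "'f trm list"

datatype ('f, 'r) fm =
    Eq "'f trm" "'f trm"
  | Less "'f trm" "'f trm"
  | Rl 'r "'f trm list"
  | Neg "('f, 'r) fm"
  | Conj "('f, 'r) fm" "('f, 'r) fm"
  | Ex nat "('f, 'r) fm"

text \<open>A language \<open>L\<close> records its symbols other than \<open>0, 1, +, \<cdot>, <\<close>, which are built into terms and
  formulas: \<open>fsyms L n\<close> and \<open>rsyms L n\<close> are its further \<open>n\<close>-ary function and relation symbols.\<close>

record ('f, 'r) lang =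
  fsyms :: "nat \<Rightarrow> 'f set"
  rsyms :: "nat \<Rightarrow> 'r set"

fun wf_trm :: "('f, 'r) lang \<Rightarrow> 'f trm \<Rightarrow> bool" where
  "wf_trm L (Var i) = True"
| "wf_trm L Zero = True"
| "wf_trm L One = True"
| "wf_trm L (Add s t) = (wf_trm L s \<and> wf_trm L t)"
| "wf_trm L (Mul s t) = (wf_trm L s \<and> wf_trm L t)"
| "wf_trm L (Fn f ts) = (f \<in> fsyms L (length ts) \<and> (\<forall>t\<in>set ts. wf_trm L t))"

fun wf_fm :: "('f, 'r) lang \<Rightarrow> ('f, 'r) fm \<Rightarrow> bool" where
  "wf_fm L (Eq s t) = (wf_trm L s \<and> wf_trm L t)"
| "wf_fm L (Less s t) = (wf_trm L s \<and> wf_trm L t)"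
| "wf_fm L (Rl p ts) = (p \<in> rsyms L (length ts) \<and> (\<forall>t\<in>set ts. wf_trm L t))"
| "wf_fm L (Neg \<phi>) = wf_fm L \<phi>"
| "wf_fm L (Conj \<phi> \<psi>) = (wf_fm L \<phi> \<and> wf_fm L \<psi>)"
| "wf_fm L (Ex i \<phi>) = wf_fm L \<phi>"

fun fv_trm :: "'f trm \<Rightarrow> nat set" where
  "fv_trm (Var i) = {i}"
| "fv_trm Zero = {}"
| "fv_trm One = {}"
| "fv_trm (Add s t) = fv_trm s \<union> fv_trm t"
| "fv_trm (Mul s t) = fv_trm s \<union> fv_trm t"
| "fv_trm (Fn f ts) = (\<Union>t\<in>set ts. fv_trm t)"

fun fv :: "('f, 'r) fm \<Rightarrow> nat set" where
  "fv (Eq s t) = fv_trm s \<union> fv_trm t"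
| "fv (Less s t) = fv_trm s \<union> fv_trm t"
| "fv (Rl p ts) = (\<Union>t\<in>set ts. fv_trm t)"
| "fv (Neg \<phi>) = fv \<phi>"
| "fv (Conj \<phi> \<psi>) = fv \<phi> \<union> fv \<psi>"
| "fv (Ex i \<phi>) = fv \<phi> - {i}"

definition sentence :: "('f, 'r) lang \<Rightarrow> ('f, 'r) fm \<Rightarrow> bool" where
  "sentence L \<sigma> \<longleftrightarrow> wf_fm L \<sigma> \<and> fv \<sigma> = {}"


section \<open>Structures and models\<close>

record ('a, 'f, 'r) ostruct = "'a ring" +
  lt :: "'a \<Rightarrow> 'a \<Rightarrow> bool"
  fint :: "'f \<Rightarrow> 'a list \<Rightarrow> 'a"
  rint :: "'r \<Rightarrow> 'a list \<Rightarrow> bool"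

definition is_struct :: "('f, 'r) lang \<Rightarrow> ('a, 'f, 'r) ostruct \<Rightarrow> bool" where
  "is_struct L M \<longleftrightarrow>
     \<zero>\<^bsub>M\<^esub> \<in> carrier M \<and> \<one>\<^bsub>M\<^esub> \<in> carrier M \<and>
     (\<forall>x\<in>carrier M. \<forall>y\<in>carrier M. x \<oplus>\<^bsub>M\<^esub> y \<in> carrier M \<and> x \<otimes>\<^bsub>M\<^esub> y \<in> carrier M) \<and>
     (\<forall>f xs. f \<in> fsyms L (length xs) \<and> set xs \<subseteq> carrier M \<longrightarrow> fint M f xs \<in> carrier M)"

primrec tval :: "('a, 'f, 'r) ostruct \<Rightarrow> (nat \<Rightarrow> 'a) \<Rightarrow> 'f trm \<Rightarrow> 'a" where
  "tval M e (Var i) = e i"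
| "tval M e Zero = \<zero>\<^bsub>M\<^esub>"
| "tval M e One = \<one>\<^bsub>M\<^esub>"
| "tval M e (Add s t) = tval M e s \<oplus>\<^bsub>M\<^esub> tval M e t"
| "tval M e (Mul s t) = tval M e s \<otimes>\<^bsub>M\<^esub> tval M e t"
| "tval M e (Fn f ts) = fint M f (map (tval M e) ts)"

primrec sat :: "('a, 'f, 'r) ostruct \<Rightarrow> (nat \<Rightarrow> 'a) \<Rightarrow> ('f, 'r) fm \<Rightarrow> bool" where
  "sat M e (Eq s t) = (tval M e s = tval M e t)"
| "sat M e (Less s t) = lt M (tval M e s) (tval M e t)"
| "sat M e (Rl p ts) = rint M p (map (tval M e) ts)"
| "sat M e (Neg \<phi>) = (\<not> sat M e \<phi>)"
| "sat M e (Conj \<phi> \<psi>) = (sat M e \<phi> \<and> sat M e \<psi>)"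
| "sat M e (Ex i \<phi>) = (\<exists>a\<in>carrier M. sat M (e(i := a)) \<phi>)"

definition holds :: "('a, 'f, 'r) ostruct \<Rightarrow> ('f, 'r) fm \<Rightarrow> bool" where
  "holds M \<sigma> \<longleftrightarrow> (\<forall>e. range e \<subseteq> carrier M \<longrightarrow> sat M e \<sigma>)"

definition models :: "('f, 'r) lang \<Rightarrow> ('f, 'r) fm set \<Rightarrow> ('a, 'f, 'r) ostruct \<Rightarrow> bool" where
  "models L T M \<longleftrightarrow> is_struct L M \<and> (\<forall>\<sigma>\<in>T. holds M \<sigma>)"

definition substructure ::
  "('f, 'r) lang \<Rightarrow> ('a, 'f, 'r) ostruct \<Rightarrow> ('a, 'f, 'r) ostruct \<Rightarrow> bool" where
  "substructure L M N \<longleftrightarrow>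
     is_struct L M \<and> is_struct L N \<and> carrier M \<subseteq> carrier N \<and>
     \<zero>\<^bsub>M\<^esub> = \<zero>\<^bsub>N\<^esub> \<and> \<one>\<^bsub>M\<^esub> = \<one>\<^bsub>N\<^esub> \<and>
     (\<forall>x\<in>carrier M. \<forall>y\<in>carrier M.
        x \<oplus>\<^bsub>M\<^esub> y = x \<oplus>\<^bsub>N\<^esub> y \<and> x \<otimes>\<^bsub>M\<^esub> y = x \<otimes>\<^bsub>N\<^esub> y \<and> (lt M x y \<longleftrightarrow> lt N x y)) \<and>
     (\<forall>f xs. f \<in> fsyms L (length xs) \<and> set xs \<subseteq> carrier M \<longrightarrow> fint M f xs = fint N f xs) \<and>
     (\<forall>p xs. p \<in> rsyms L (length xs) \<and> set xs \<subseteq> carrier M \<longrightarrow> (rint M p xs \<longleftrightarrow> rint N p xs))"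

definition elementary_substructure ::
  "('f, 'r) lang \<Rightarrow> ('a, 'f, 'r) ostruct \<Rightarrow> ('a, 'f, 'r) ostruct \<Rightarrow> bool" where
  "elementary_substructure L M N \<longleftrightarrow>
     substructure L M N \<and>
     (\<forall>\<phi> e. wf_fm L \<phi> \<and> range e \<subseteq> carrier M \<longrightarrow> (sat M e \<phi> \<longleftrightarrow> sat N e \<phi>))"

text \<open>\<open>M\<^sup>n\<close> is the set of lists of length \<open>n\<close> over \<open>carrier M\<close>. In \<open>definable L M A n X\<close> the variables
  \<open>0, \<dots>, n - 1\<close> of \<open>\<phi>\<close> range over the point, and its other free variables name parameters from \<open>A\<close>.\<close>

definition definable ::
  "('f, 'r) lang \<Rightarrow> ('a, 'f, 'r) ostruct \<Rightarrow> 'a set \<Rightarrow> nat \<Rightarrow> 'a list set \<Rightarrow> bool" where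
  "definable L M A n X \<longleftrightarrow>
     (\<exists>\<phi> e. wf_fm L \<phi> \<and> (\<forall>i\<in>fv \<phi>. n \<le> i \<longrightarrow> e i \<in> A) \<and>
        X = {xs. length xs = n \<and> set xs \<subseteq> carrier M \<and>
                 sat M (\<lambda>i. if i < n then xs ! i else e i) \<phi>})"

definition definable_fun ::
  "('f, 'r) lang \<Rightarrow> ('a, 'f, 'r) ostruct \<Rightarrow> 'a set \<Rightarrow> nat \<Rightarrow> 'a list set \<Rightarrow> ('a list \<Rightarrow> 'a) \<Rightarrow> bool"
  where
  "definable_fun L M A n U F \<longleftrightarrow>
     (\<forall>xs\<in>U. length xs = n \<and> set xs \<subseteq> carrier M \<and> F xs \<in> carrier M) \<and>
     definable L M A (Suc n) {xs @ [F xs] | xs. xs \<in> U}"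

definition definable_fun1 ::
  "('f, 'r) lang \<Rightarrow> ('a, 'f, 'r) ostruct \<Rightarrow> 'a set \<Rightarrow> 'a set \<Rightarrow> ('a \<Rightarrow> 'a) \<Rightarrow> bool" where
  "definable_fun1 L M A U f \<longleftrightarrow>
     definable_fun L M A 1 {[x] | x. x \<in> U} (\<lambda>xs. f (hd xs))"


section \<open>Properties of theories\<close>

definition real_closed_ordered_field :: "('a, 'f, 'r) ostruct \<Rightarrow> bool" where
  "real_closed_ordered_field M \<longleftrightarrow>
     field M \<and>
     (\<forall>x\<in>carrier M. \<not> lt M x x) \<and>
     (\<forall>x\<in>carrier M. \<forall>y\<in>carrier M. \<forall>z\<in>carrier M. lt M x y \<and> lt M y z \<longrightarrow> lt M x z) \<and>
     (\<forall>x\<in>carrier M. \<forall>y\<in>carrier M. lt M x y \<or> x = y \<or> lt M y x) \<and>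
     (\<forall>x\<in>carrier M. \<forall>y\<in>carrier M. \<forall>z\<in>carrier M. lt M x y \<longrightarrow> lt M (x \<oplus>\<^bsub>M\<^esub> z) (y \<oplus>\<^bsub>M\<^esub> z)) \<and>
     (\<forall>x\<in>carrier M. \<forall>y\<in>carrier M.
        lt M \<zero>\<^bsub>M\<^esub> x \<and> lt M \<zero>\<^bsub>M\<^esub> y \<longrightarrow> lt M \<zero>\<^bsub>M\<^esub> (x \<otimes>\<^bsub>M\<^esub> y)) \<and>
     (\<forall>x\<in>carrier M. lt M \<zero>\<^bsub>M\<^esub> x \<longrightarrow> (\<exists>y\<in>carrier M. y \<otimes>\<^bsub>M\<^esub> y = x)) \<and>
     (\<forall>n c. odd n \<and> (\<forall>i<n. c i \<in> carrier M) \<longrightarrow>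
        (\<exists>x\<in>carrier M.
           x [^]\<^bsub>M\<^esub> (n::nat) \<oplus>\<^bsub>M\<^esub> (\<Oplus>\<^bsub>M\<^esub>i\<in>{..<n}. c i \<otimes>\<^bsub>M\<^esub> x [^]\<^bsub>M\<^esub> i) = \<zero>\<^bsub>M\<^esub>))"

text \<open>Points, and open intervals with endpoints in the structure or infinite.\<close>

definition point_or_interval :: "('a, 'f, 'r) ostruct \<Rightarrow> 'a set \<Rightarrow> bool" where
  "point_or_interval M I \<longleftrightarrow>
     (\<exists>a\<in>carrier M. I = {a}) \<or>
     (\<exists>a\<in>carrier M. \<exists>b\<in>carrier M. I = {x\<in>carrier M. lt M a x \<and> lt M x b}) \<or>
     (\<exists>a\<in>carrier M. I = {x\<in>carrier M. lt M a x}) \<or>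
     (\<exists>b\<in>carrier M. I = {x\<in>carrier M. lt M x b}) \<or>
     I = carrier M"

definition o_minimal :: "('f, 'r) lang \<Rightarrow> ('a, 'f, 'r) ostruct \<Rightarrow> bool" where
  "o_minimal L M \<longleftrightarrow>
     (\<forall>D \<subseteq> carrier M. definable L M (carrier M) 1 {[x] | x. x \<in> D} \<longrightarrow>
        (\<exists>\<I>. finite \<I> \<and> (\<forall>I\<in>\<I>. point_or_interval M I) \<and> D = \<Union>\<I>))"

definition positives :: "('a, 'f, 'r) ostruct \<Rightarrow> 'a set" where
  "positives M = {x\<in>carrier M. lt M \<zero>\<^bsub>M\<^esub> x}"

definition le :: "('a, 'f, 'r) ostruct \<Rightarrow> 'a \<Rightarrow> 'a \<Rightarrow> bool" where
  "le M x y \<longleftrightarrow> lt M x y \<or> x = y"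

definition power_function :: "('f, 'r) lang \<Rightarrow> ('a, 'f, 'r) ostruct \<Rightarrow> ('a \<Rightarrow> 'a) \<Rightarrow> bool" where
  "power_function L M p \<longleftrightarrow>
     definable_fun1 L M (carrier M) (positives M) p \<and>
     (\<forall>x\<in>positives M. p x \<in> positives M) \<and>
     (\<forall>x\<in>positives M. \<forall>y\<in>positives M. p (x \<otimes>\<^bsub>M\<^esub> y) = p x \<otimes>\<^bsub>M\<^esub> p y) \<and>
     (\<forall>x\<in>positives M. \<forall>y\<in>positives M. le M x y \<longrightarrow> le M (p x) (p y))"

text \<open>The last line spells out \<open>\<bar>f x\<bar> \<le> p x\<close>.\<close>

definition power_bounded :: "('f, 'r) lang \<Rightarrow> ('a, 'f, 'r) ostruct \<Rightarrow> bool" where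
  "power_bounded L M \<longleftrightarrow>
     (\<forall>f. definable_fun1 L M (carrier M) (carrier M) f \<longrightarrow>
        (\<exists>p. power_function L M p \<and>
           (\<exists>a\<in>positives M. \<forall>x\<in>carrier M. lt M a x \<longrightarrow>
              le M (f x) (p x) \<and> le M (\<ominus>\<^bsub>M\<^esub> p x) (f x))))"

text \<open>HOL cannot quantify over models of all types at once, so the notions below, which speak of all
  models of \<open>T\<close>, range over the models whose carrier is a subset of a type \<open>'u\<close>. If \<open>'u\<close> is at least
  as large as the set of formulas, this is no restriction: by the downward
  Loewenheim-Skolem theorem (applied, for model completeness, to a pair consisting of a model and a
  substructure), a model that violates the property has an elementary substructure of size at most
  \<open>\<bar>L\<bar> + \<aleph>\<^sub>0\<close> that violates it as well.\<close>

definition complete_theory :: "'u itself \<Rightarrow> ('f, 'r) lang \<Rightarrow> ('f, 'r) fm set \<Rightarrow> bool" where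
  "complete_theory _ L T \<longleftrightarrow>
     (\<forall>\<sigma>. sentence L \<sigma> \<longrightarrow>
        (\<forall>M::('u, 'f, 'r) ostruct. models L T M \<longrightarrow> holds M \<sigma>) \<or>
        (\<forall>M::('u, 'f, 'r) ostruct. models L T M \<longrightarrow> holds M (Neg \<sigma>)))"

definition model_complete_theory :: "'u itself \<Rightarrow> ('f, 'r) lang \<Rightarrow> ('f, 'r) fm set \<Rightarrow> bool" where
  "model_complete_theory _ L T \<longleftrightarrow>
     (\<forall>(M::('u, 'f, 'r) ostruct) N. models L T M \<and> models L T N \<and> substructure L M N \<longrightarrow>
        elementary_substructure L M N)"

definition o_minimal_theory :: "'u itself \<Rightarrow> ('f, 'r) lang \<Rightarrow> ('f, 'r) fm set \<Rightarrow> bool" where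
  "o_minimal_theory _ L T \<longleftrightarrow> (\<forall>M::('u, 'f, 'r) ostruct. models L T M \<longrightarrow> o_minimal L M)"

definition power_bounded_theory :: "'u itself \<Rightarrow> ('f, 'r) lang \<Rightarrow> ('f, 'r) fm set \<Rightarrow> bool" where
  "power_bounded_theory _ L T \<longleftrightarrow> (\<forall>M::('u, 'f, 'r) ostruct. models L T M \<longrightarrow> power_bounded L M)"

definition extends_RCF :: "'u itself \<Rightarrow> ('f, 'r) lang \<Rightarrow> ('f, 'r) fm set \<Rightarrow> bool" where
  "extends_RCF _ L T \<longleftrightarrow>
     (\<forall>M::('u, 'f, 'r) ostruct. models L T M \<longrightarrow> real_closed_ordered_field M)"

text \<open>A universe that is large enough in the above sense, and also contains a copy of \<open>'k\<close>.\<close>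

type_synonym ('f, 'r, 'k) universe = "('f, 'r) fm + 'k"


section \<open>Expansions of an ordered field\<close>

definition expansion ::
  "('f \<Rightarrow> 'k list \<Rightarrow> 'k) \<Rightarrow> ('r \<Rightarrow> 'k list \<Rightarrow> bool) \<Rightarrow> ('k::linordered_field, 'f, 'r) ostruct" where
  "expansion \<F> \<R> =
     \<lparr>carrier = UNIV, mult = (*), one = 1, zero = 0, add = (+), lt = (<), fint = \<F>, rint = \<R>\<rparr>"

text \<open>The order topology on \<open>K\<close> and the product topology on \<open>K\<^sup>n\<close>, the latter through the boxes
  \<open>box n u d\<close>.\<close>

definition continuous1 :: "('k::linordered_field \<Rightarrow> 'k) \<Rightarrow> bool" where
  "continuous1 f \<longleftrightarrow> (\<forall>x. \<forall>\<epsilon>>0. \<exists>\<delta>>0. \<forall>y. \<bar>y - x\<bar> < \<delta> \<longrightarrow> \<bar>f y - f x\<bar> < \<epsilon>)"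

definition box :: "nat \<Rightarrow> 'k::linordered_field list \<Rightarrow> 'k \<Rightarrow> 'k list set" where
  "box n u d = {y. length y = n \<and> (\<forall>i<n. \<bar>y ! i - u ! i\<bar> < d)}"

definition open_set :: "nat \<Rightarrow> 'k::linordered_field list set \<Rightarrow> bool" where
  "open_set n U \<longleftrightarrow> (\<forall>u\<in>U. length u = n \<and> (\<exists>\<delta>>0. box n u \<delta> \<subseteq> U))"

definition continuous_fun :: "nat \<Rightarrow> 'k::linordered_field list set \<Rightarrow> ('k list \<Rightarrow> 'k) \<Rightarrow> bool" where
  "continuous_fun n U F \<longleftrightarrow>
     (\<forall>u\<in>U. \<forall>\<epsilon>>0. \<exists>\<delta>>0. \<forall>y\<in>U \<inter> box n u \<delta>. \<bar>F y - F u\<bar> < \<epsilon>)"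

definition has_partial ::
  "'k::linordered_field list set \<Rightarrow> ('k list \<Rightarrow> 'k) \<Rightarrow> nat \<Rightarrow> 'k list \<Rightarrow> 'k \<Rightarrow> bool" where
  "has_partial U F i u D \<longleftrightarrow>
     (\<forall>\<epsilon>>0. \<exists>\<delta>>0. \<forall>h. h \<noteq> 0 \<and> \<bar>h\<bar> < \<delta> \<and> u[i := u ! i + h] \<in> U \<longrightarrow>
        \<bar>(F (u[i := u ! i + h]) - F u) / h - D\<bar> < \<epsilon>)"

text \<open>\<open>C1_fun n U F G\<close>: \<open>F\<close> is \<open>C\<^sup>1\<close> on the open set \<open>U\<close>, with partial derivatives \<open>G 0, \<dots>, G (n - 1)\<close>.\<close>

definition C1_fun ::
  "nat \<Rightarrow> 'k::linordered_field list set \<Rightarrow> ('k list \<Rightarrow> 'k) \<Rightarrow> (nat \<Rightarrow> 'k list \<Rightarrow> 'k) \<Rightarrow> bool" where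
  "C1_fun n U F G \<longleftrightarrow>
     (\<forall>i<n. (\<forall>u\<in>U. has_partial U F i u (G i u)) \<and> continuous_fun n U (G i))"

definition T_derivation ::
  "('f, 'r) lang \<Rightarrow> ('k::linordered_field, 'f, 'r) ostruct \<Rightarrow> ('k \<Rightarrow> 'k) \<Rightarrow> bool" where
  "T_derivation L K der \<longleftrightarrow>
     (\<forall>n U F G. open_set n U \<and> definable_fun L K {} n U F \<and> C1_fun n U F G \<longrightarrow>
        (\<forall>u\<in>U. der (F u) = (\<Sum>i<n. G i u * der (u ! i))))"

definition T_convex ::
  "('f, 'r) lang \<Rightarrow> ('k::linordered_field, 'f, 'r) ostruct \<Rightarrow> 'k set \<Rightarrow> bool" where
  "T_convex L K \<O> \<longleftrightarrow>
     \<O> \<noteq> {} \<and> (\<forall>x\<in>\<O>. \<forall>z\<in>\<O>. \<forall>y. x \<le> y \<and> y \<le> z \<longrightarrow> y \<in> \<O>) \<and>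
     (\<forall>F. definable_fun1 L K {} UNIV F \<and> continuous1 F \<longrightarrow> F ` \<O> \<subseteq> \<O>)"


section \<open>The valuation and the differential residue field\<close>

definition unit_group :: "'k::linordered_field set \<Rightarrow> 'k set" where
  "unit_group \<O> = {a\<in>\<O>. a \<noteq> 0 \<and> inverse a \<in> \<O>}"

definition max_ideal :: "'k::linordered_field set \<Rightarrow> 'k set" where
  "max_ideal \<O> = \<O> - unit_group \<O>"

text \<open>The value group is the group of cosets \<open>a \<O>\<^sup>\<times>\<close> with \<open>a \<noteq> 0\<close>, ordered by
  \<open>a \<O>\<^sup>\<times> \<le> b \<O>\<^sup>\<times>\<close> iff \<open>b / a \<in> \<O>\<close>; the value \<open>\<infinity>\<close> of \<open>0\<close> is \<open>{0}\<close>.\<close>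

definition val :: "'k::linordered_field set \<Rightarrow> 'k \<Rightarrow> 'k set" where
  "val \<O> a = {a * u | u. u \<in> unit_group \<O>}"

definition vle :: "'k::linordered_field set \<Rightarrow> 'k set \<Rightarrow> 'k set \<Rightarrow> bool" where
  "vle \<O> \<gamma> \<delta> \<longleftrightarrow> (\<exists>a\<in>\<gamma>. \<exists>b\<in>\<delta>. \<exists>c\<in>\<O>. b = c * a)"

lemma vle_val_iff:
  assumes "1 \<in> \<O>" and mult: "\<And>x y. x \<in> \<O> \<Longrightarrow> y \<in> \<O> \<Longrightarrow> x * y \<in> \<O>"
  shows "vle \<O> (val \<O> a) (val \<O> b) \<longleftrightarrow> (\<exists>c\<in>\<O>. b = c * a)"
proof
  assume "vle \<O> (val \<O> a) (val \<O> b)"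
  then obtain u w c where u: "u \<in> unit_group \<O>" and w: "w \<in> unit_group \<O>"
    and c: "c \<in> \<O>" "b * w = c * (a * u)"
    by (auto simp: vle_def val_def)
  have "b = (c * u * inverse w) * a"
    using w c(2) by (simp add: unit_group_def field_simps)
  moreover have "c * u * inverse w \<in> \<O>"
    using u w c(1) mult by (auto simp: unit_group_def)
  ultimately show "\<exists>c\<in>\<O>. b = c * a" by blast
next
  assume "\<exists>c\<in>\<O>. b = c * a"
  moreover have "x \<in> val \<O> x" for x
    using assms(1) by (auto simp: val_def unit_group_def intro!: exI[of _ 1])
  ultimately show "vle \<O> (val \<O> a) (val \<O> b)" by (auto simp: vle_def)
qed

lemma vle_val_antisym:
  assumes "1 \<in> \<O>" and mult: "\<And>x y. x \<in> \<O> \<Longrightarrow> y \<in> \<O> \<Longrightarrow> x * y \<in> \<O>"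
    and "vle \<O> (val \<O> a) (val \<O> b)" "vle \<O> (val \<O> b) (val \<O> a)"
  shows "val \<O> a = val \<O> b"
proof -
  have iff: "vle \<O> (val \<O> x) (val \<O> y) \<longleftrightarrow> (\<exists>c\<in>\<O>. y = c * x)" for x y
    by (rule vle_val_iff) (use assms(1,2) in auto)
  obtain c where c: "c \<in> \<O>" "b = c * a"
    using assms(3) unfolding iff by (elim bexE)
  obtain d where d: "d \<in> \<O>" "a = d * b"
    using assms(4) unfolding iff by (elim bexE)
  show ?thesis
  proof (cases "a = 0")
    case False
    have "(d * c) * a = 1 * a" using c(2) d(2) by (simp only: mult_1 mult.assoc)
    then have dc: "d * c = 1" "c \<noteq> 0" "d \<noteq> 0" using False by auto
    then have inv: "inverse c = d" "inverse d = c" by (auto simp: field_simps)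
    have *: "x * u \<in> unit_group \<O>" if "u \<in> unit_group \<O>" "x \<in> unit_group \<O>" for x u
      using that mult by (auto simp: unit_group_def)
    have cu: "c \<in> unit_group \<O>" and du: "d \<in> unit_group \<O>"
      using c d dc inv by (auto simp: unit_group_def)
    have "val \<O> b \<subseteq> val \<O> a"
    proof
      fix x assume "x \<in> val \<O> b"
      then obtain u where "u \<in> unit_group \<O>" "x = b * u" by (auto simp: val_def)
      then show "x \<in> val \<O> a" using *[OF _ cu] c by (auto simp: val_def intro!: exI[of _ "c * u"])
    qed
    moreover have "val \<O> a \<subseteq> val \<O> b"
    proof
      fix x assume "x \<in> val \<O> a"
      then obtain u where "u \<in> unit_group \<O>" "x = a * u" by (auto simp: val_def)
      then show "x \<in> val \<O> b" using *[OF _ du] d(2) by (auto simp: val_def intro!: exI[of _ "d * u"])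
    qed
    ultimately show ?thesis by blast
  qed (use c in simp)
qed

definition vless :: "'k::linordered_field set \<Rightarrow> 'k set \<Rightarrow> 'k set \<Rightarrow> bool" where
  "vless \<O> \<gamma> \<delta> \<longleftrightarrow> vle \<O> \<gamma> \<delta> \<and> \<gamma> \<noteq> \<delta>"

definition vball :: "'k::linordered_field set \<Rightarrow> 'k \<Rightarrow> 'k set \<Rightarrow> 'k set" where
  "vball \<O> a \<gamma> = {b. vle \<O> \<gamma> (val \<O> (b - a))}"

definition spherically_complete :: "'k::linordered_field set \<Rightarrow> bool" where
  "spherically_complete \<O> \<longleftrightarrow>
     (\<forall>\<B>. \<B> \<noteq> {} \<and> \<B> \<subseteq> {vball \<O> a \<gamma> | a \<gamma>. \<gamma> \<in> range (val \<O>)} \<and>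
          (\<forall>B\<in>\<B>. \<forall>C\<in>\<B>. B \<inter> C \<noteq> {}) \<longrightarrow> \<Inter>\<B> \<noteq> {})"

definition val_ring :: "'k::linordered_field set \<Rightarrow> 'k ring" where
  "val_ring \<O> = \<lparr>carrier = \<O>, mult = (*), one = 1, zero = 0, add = (+)\<rparr>"

definition residue_field :: "'k::linordered_field set \<Rightarrow> 'k set ring" where
  "residue_field \<O> = val_ring \<O> Quot max_ideal \<O>"

text \<open>For \<open>der\<close> with \<open>der \<O> \<subseteq> \<O>\<close> and \<open>der \<oo> \<subseteq> \<oo>\<close>, the residue classes of all \<open>der x\<close> with \<open>x\<close> in a residue
  class \<open>X\<close> coincide, and their union is the class that the induced derivation assigns to \<open>X\<close>.\<close>

definition residue_derivation ::
  "'k::linordered_field set \<Rightarrow> ('k \<Rightarrow> 'k) \<Rightarrow> 'k set \<Rightarrow> 'k set" where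
  "residue_derivation \<O> der X = (\<Union>x\<in>X. max_ideal \<O> +>\<^bsub>val_ring \<O>\<^esub> der x)"

definition linearly_surjective :: "'b ring \<Rightarrow> ('b \<Rightarrow> 'b) \<Rightarrow> bool" where
  "linearly_surjective R d \<longleftrightarrow>
     (\<forall>s c. (\<forall>i\<le>s. c i \<in> carrier R) \<and> (\<exists>i\<le>s. c i \<noteq> \<zero>\<^bsub>R\<^esub>) \<longrightarrow>
        (\<forall>b\<in>carrier R. \<exists>y\<in>carrier R.
           (\<Oplus>\<^bsub>R\<^esub>i\<in>{..s::nat}. c i \<otimes>\<^bsub>R\<^esub> (d ^^ i) y) = b))"


section \<open>Linear differential operators\<close>

text \<open>The operator \<open>a\<^sub>0 + a\<^sub>1 \<partial> + \<dots> + a\<^sub>s \<partial>\<^sup>s\<close> is represented by the polynomial with coefficients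
  \<open>a\<^sub>0, \<dots>, a\<^sub>s\<close>, where \<open>\<partial>\<close> acts as \<open>der\<close>; the (noncommutative) product of operators is not that of polynomials.\<close>

definition dop_apply :: "('k \<Rightarrow> 'k) \<Rightarrow> 'k::linordered_field poly \<Rightarrow> 'k \<Rightarrow> 'k" where
  "dop_apply der A y = (\<Sum>i\<le>degree A. coeff A i * (der ^^ i) y)"

text \<open>\<open>A\<^bsub>\<times>g\<^esub>\<close>, with coefficients given by the Leibniz rule
  \<open>\<partial>\<^sup>i g = (\<Sum>j\<le>i. (i choose j) g\<^bsup>(i - j)\<^esup> \<partial>\<^sup>j)\<close> in \<open>K[\<partial>]\<close>.\<close>

definition dop_times :: "('k \<Rightarrow> 'k) \<Rightarrow> 'k::linordered_field poly \<Rightarrow> 'k \<Rightarrow> 'k poly" where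
  "dop_times der A g =
     (\<Sum>i\<le>degree A. \<Sum>j\<le>i. monom (coeff A i * of_nat (i choose j) * (der ^^ (i - j)) g) j)"

lemma dop_apply_sum_monom:
  "dop_apply der (\<Sum>i\<in>I. f i) y = (\<Sum>i\<in>I. dop_apply der (f i) y)" (is ?sum)
  "dop_apply der (monom c j) y = c * (der ^^ j) y" (is ?monom)
proof -
  have ext: "dop_apply der A y = (\<Sum>i\<le>N. coeff A i * (der ^^ i) y)" if "degree A \<le> N" for A N
    unfolding dop_apply_def by (rule sum.mono_neutral_left) (use that in \<open>auto simp: coeff_eq_0\<close>)
  have plus: "dop_apply der (A + B) y = dop_apply der A y + dop_apply der B y" for A B
  proof -
    define N where "N = max (degree A) (degree B)"
    have "degree (A + B) \<le> N" "degree A \<le> N" "degree B \<le> N"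
      by (auto simp: N_def degree_add_le_max)
    then show ?thesis by (simp add: ext sum.distrib ring_distribs)
  qed
  show ?sum
    by (induction I rule: infinite_finite_induct) (auto simp: plus, auto simp: dop_apply_def)
  have "dop_apply der (monom c j) y = (\<Sum>i\<le>j. coeff (monom c j) i * (der ^^ i) y)"
    by (rule ext) (simp add: degree_monom_le)
  also have "\<dots> = (\<Sum>i\<le>j. if i = j then c * (der ^^ i) y else 0)"
    by (intro sum.cong) auto
  finally show ?monom by simp
qed

lemma dop_apply_dop_times:
  assumes add: "\<And>x y. der (x + y) = der x + der y"
    and mult: "\<And>x y. der (x * y) = der x * y + x * der y"
  shows "dop_apply der (dop_times der A g) y = dop_apply der A (g * y)"
proof -
  have z: "der 0 = 0" using add[of 0 0] by simp
  have sum: "der (\<Sum>i\<in>I. f i) = (\<Sum>i\<in>I. der (f i))" for I :: "nat set" and f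
    by (induction I rule: infinite_finite_induct) (auto simp: z add)
  have "der 1 = 0" using mult[of 1 1] by simp
  then have of_nat: "der (of_nat n) = 0" for n by (induction n) (auto simp: z add)
  have nat: "der (of_nat n * x) = of_nat n * der x" for n x by (simp add: mult of_nat)
  have leib: "(der ^^ i) (g * y) = (\<Sum>j\<le>i. of_nat (i choose j) * ((der ^^ (i - j)) g * (der ^^ j) y))" for i
  proof (induction i)
    case (Suc i)
    let ?t = "\<lambda>a b. (der ^^ a) g * (der ^^ b) y"
    have "(der ^^ Suc i) (g * y)
        = (\<Sum>j\<le>i. of_nat (i choose j) * ?t (Suc (i - j)) j) + (\<Sum>j\<le>i. of_nat (i choose j) * ?t (i - j) (Suc j))"
      by (simp only: funpow.simps o_apply Suc sum nat) (simp only: mult ring_distribs sum.distrib)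
    also have "(\<Sum>j\<le>i. of_nat (i choose j) * ?t (Suc (i - j)) j)
        = (\<Sum>j\<le>Suc i. of_nat (i choose j) * ?t (Suc i - j) j)"
      by (auto simp: Suc_diff_le intro!: sum.cong)
    also have "\<dots> = ?t (Suc i) 0 + (\<Sum>j\<le>i. of_nat (i choose Suc j) * ?t (i - j) (Suc j))"
      by (subst sum.atMost_Suc_shift) simp
    also have "\<dots> + (\<Sum>j\<le>i. of_nat (i choose j) * ?t (i - j) (Suc j))
        = ?t (Suc i) 0 + (\<Sum>j\<le>i. of_nat (Suc i choose Suc j) * ?t (i - j) (Suc j))"
      by (simp add: sum.distrib ring_distribs add_ac)
    also have "\<dots> = (\<Sum>j\<le>Suc i. of_nat (Suc i choose j) * ?t (Suc i - j) j)"
      by (subst sum.atMost_Suc_shift) simp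
    finally show ?case .
  qed simp
  show ?thesis
    unfolding dop_times_def dop_apply_sum_monom
    by (simp only: dop_apply_def[of _ A] leib sum_distrib_left mult.assoc)
qed

definition dop_val :: "'k::linordered_field set \<Rightarrow> 'k poly \<Rightarrow> 'k set" where
  "dop_val \<O> A =
     (THE \<gamma>. \<gamma> \<in> (\<lambda>i. val \<O> (coeff A i)) ` {..degree A} \<and>
             (\<forall>i\<le>degree A. vle \<O> \<gamma> (val \<O> (coeff A i))))"


section \<open>\<open>T\<^sup>\<partial>\<close>-henselianity\<close>

definition jet :: "('k \<Rightarrow> 'k) \<Rightarrow> nat \<Rightarrow> 'k \<Rightarrow> 'k list" where
  "jet der r a = map (\<lambda>i. (der ^^ i) a) [0..<Suc r]"

definition implicit_form ::
  "('f, 'r) lang \<Rightarrow> ('k::linordered_field, 'f, 'r) ostruct \<Rightarrow> nat \<Rightarrow> ('k list \<Rightarrow> 'k) \<Rightarrow> bool" where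
  "implicit_form L K r F \<longleftrightarrow>
     (\<exists>m I. m \<noteq> 0 \<and> definable_fun L K UNIV r {ys. length ys = r} I \<and>
        (\<forall>ys. length ys = Suc r \<longrightarrow> F ys = m * (ys ! r - I (take r ys))))"

definition linearly_approximates ::
  "'k::linordered_field set \<Rightarrow> ('k \<Rightarrow> 'k) \<Rightarrow> nat \<Rightarrow> 'k poly \<Rightarrow> ('k list \<Rightarrow> 'k) \<Rightarrow> 'k set \<Rightarrow> bool" where
  "linearly_approximates \<O> der r A F B \<longleftrightarrow>
     A \<noteq> 0 \<and>
     (\<forall>a\<in>B. \<forall>b\<in>B. a \<noteq> b \<longrightarrow>
        vless \<O> (dop_val \<O> (dop_times der A (b - a)))
                (val \<O> (F (jet der r b) - F (jet der r a) - dop_apply der A (b - a))))"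

definition T_henselian ::
  "('f, 'r) lang \<Rightarrow> ('k::linordered_field, 'f, 'r) ostruct \<Rightarrow> 'k set \<Rightarrow> ('k \<Rightarrow> 'k) \<Rightarrow> bool" where
  "T_henselian L K \<O> der \<longleftrightarrow>
     linearly_surjective (residue_field \<O>) (residue_derivation \<O> der) \<and>
     (\<forall>r F A.
        definable_fun L K UNIV (Suc r) {ys. length ys = Suc r} F \<and> implicit_form L K r F \<and>
        A \<noteq> 0 \<and> linearly_approximates \<O> der r A F (max_ideal \<O>) \<and>
        vless \<O> (dop_val \<O> A) (val \<O> (F (replicate (Suc r) 0))) \<longrightarrow>
        (\<exists>\<epsilon>\<in>max_ideal \<O>. F (jet der r \<epsilon>) = 0 \<and>
           vle \<O> (val \<O> (F (replicate (Suc r) 0))) (dop_val \<O> (dop_times der A \<epsilon>))))"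

text \<open>\<open>(K, \<O>, der) \<Turnstile> T\<^bsup>\<O>,\<partial>\<^esup>\<close>.\<close>

definition models_TO ::
  "('f, 'r) lang \<Rightarrow> ('f, 'r) fm set \<Rightarrow> ('k::linordered_field, 'f, 'r) ostruct \<Rightarrow> 'k set \<Rightarrow>
     ('k \<Rightarrow> 'k) \<Rightarrow> bool" where
  "models_TO L T K \<O> der \<longleftrightarrow>
     models L T K \<and> T_convex L K \<O> \<and> \<O> \<noteq> UNIV \<and>
     T_derivation L K der \<and> der ` max_ideal \<O> \<subseteq> max_ideal \<O>"

end

(*
Linear surjectivity of the residue field solves linear equations up to a smaller error, and spherical
completeness supplies limits of the resulting approximations (Zorn's lemma). This needs an equalizer
theorem: every value is of the form v(A_{\times g}). Now v(g'/g) = o(v g), and v(A_{\times g}) is v g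
plus the value of the operator obtained from A by replacing \partial with \partial + g'/g. By spherical
completeness some z is so close to g'/g for all relevant g that g'/g may be replaced by z up to a
negligible error; then v(A_{\times g}) is v g plus a constant, and v g can be chosen at will.
*)
theory Submission
  imports Defs
begin

section \<open>Valuation rings with a small derivation\<close>

text \<open>The map v g -> v(A_\<times>g) is strictly increasing, so the equalizer theorem is about
  hitting a prescribed value v f. The obstacle is that g'/g need not be bounded uniformly in g, so
  no z can be expected to approximate all g'/g to a fixed precision. Precision is therefore measured
  by the distance of v(A_\<times>g) from v f: the ball around g'/g is the smaller, the closer g is
  to a solution, and z depends on f. The resulting error is harmless because o(v g) is stable under
  finite multiples: any fixed power of an element whose value is o(v g) is still negligible,
  whatever the order of A. The search for a zero is a Newton iteration, and the equalizer theorem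
  supplies the scale of each correction. A sequence of corrections need not reach a zero, since its
  values need not be cofinal in the value group; the iteration is transfinite, whence Zorn's
  lemma.\<close>

locale small_derivation =
  fixes \<O> :: "'k::linordered_field set" and der :: "'k \<Rightarrow> 'k"
  assumes one_mem: "1 \<in> \<O>"
    and add_mem: "x \<in> \<O> \<Longrightarrow> y \<in> \<O> \<Longrightarrow> x + y \<in> \<O>"
    and minus_mem: "x \<in> \<O> \<Longrightarrow> - x \<in> \<O>"
    and mult_mem: "x \<in> \<O> \<Longrightarrow> y \<in> \<O> \<Longrightarrow> x * y \<in> \<O>"
    and inverse_mem: "x \<notin> \<O> \<Longrightarrow> inverse x \<in> \<O>"
    and der_add: "der (x + y) = der x + der y"
    and der_mult: "der (x * y) = der x * y + x * der y"
    and der_small: "x \<in> max_ideal \<O> \<Longrightarrow> der x \<in> max_ideal \<O>"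
begin

text \<open>This is v x \<ge> v y, so small elements have large values. Comparing field elements
  keeps the cosets that represent values out of the estimates. The strict form, as a negation,
  forces its larger side to be nonzero.\<close>

definition dom :: "'k \<Rightarrow> 'k \<Rightarrow> bool" (infix "\<preceq>" 50) where
  "x \<preceq> y \<longleftrightarrow> (\<exists>c\<in>\<O>. x = c * y)"

abbreviation sdom :: "'k \<Rightarrow> 'k \<Rightarrow> bool" (infix "\<prec>" 50) where
  "x \<prec> y \<equiv> \<not> y \<preceq> x"

definition equi :: "'k \<Rightarrow> 'k \<Rightarrow> bool" (infix "\<asymp>" 50) where
  "x \<asymp> y \<longleftrightarrow> x \<preceq> y \<and> y \<preceq> x"

lemma zero_mem: "0 \<in> \<O>"
  using add_mem[OF one_mem minus_mem[OF one_mem]] by simp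

lemma dom_refl [simp]: "x \<preceq> x"
  unfolding dom_def using one_mem by force

lemma dom_trans [trans]: "x \<preceq> y \<Longrightarrow> y \<preceq> z \<Longrightarrow> x \<preceq> z"
  unfolding dom_def using mult_mem by (metis mult.assoc)

lemma dom_divide_iff: "y \<noteq> 0 \<Longrightarrow> x \<preceq> y \<longleftrightarrow> x / y \<in> \<O>"
  unfolding dom_def by (auto simp: field_simps intro!: bexI[of _ "x / y"])

lemma dom_one_iff: "x \<preceq> 1 \<longleftrightarrow> x \<in> \<O>"
  by (simp add: dom_divide_iff)

lemma zero_dom [simp]: "0 \<preceq> x"
  unfolding dom_def using zero_mem by force

lemma dom_zero_iff [simp]: "x \<preceq> 0 \<longleftrightarrow> x = 0"
  unfolding dom_def using zero_mem by auto

lemma dom_total: "x \<preceq> y \<or> y \<preceq> x"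
proof (cases "x = 0 \<or> y = 0")
  case False
  then show ?thesis using inverse_mem[of "x / y"] by (auto simp: dom_divide_iff)
qed auto

lemma sdom_imp_dom: "x \<prec> y \<Longrightarrow> x \<preceq> y"
  using dom_total by blast

lemma sdom_dom_trans: "x \<prec> y \<Longrightarrow> y \<preceq> z \<Longrightarrow> x \<prec> z"
  using dom_trans by blast

lemma dom_sdom_trans: "x \<preceq> y \<Longrightarrow> y \<prec> z \<Longrightarrow> x \<prec> z"
  using dom_trans by blast

lemma dom_add: "x \<preceq> z \<Longrightarrow> y \<preceq> z \<Longrightarrow> x + y \<preceq> z"
  unfolding dom_def using add_mem by (metis distrib_right)

lemma dom_minus_iff [simp]: "- x \<preceq> y \<longleftrightarrow> x \<preceq> y"
  unfolding dom_def using minus_mem by (metis minus_mult_left minus_minus)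

lemma dom_diff: "x \<preceq> z \<Longrightarrow> y \<preceq> z \<Longrightarrow> x - y \<preceq> z"
  using dom_add[of x z "- y"] by simp

lemma dom_commute: "x - y \<preceq> z \<longleftrightarrow> y - x \<preceq> z"
  using dom_minus_iff[of "x - y" z] by simp

lemma dom_sum: "(\<And>i. i \<in> I \<Longrightarrow> f i \<preceq> z) \<Longrightarrow> (\<Sum>i\<in>I. f i) \<preceq> z"
  by (induction I rule: infinite_finite_induct) (auto intro: dom_add)

lemma sdom_add: "x \<prec> z \<Longrightarrow> y \<prec> z \<Longrightarrow> x + y \<prec> z"
proof -
  assume a: "x \<prec> z" "y \<prec> z"
  have "x + y \<preceq> x \<or> x + y \<preceq> y"
    using dom_total[of x y] by (auto intro: dom_add)
  then show ?thesis using a dom_trans by blast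
qed

lemma sdom_minus_iff [simp]: "x \<preceq> - y \<longleftrightarrow> x \<preceq> y"
  unfolding dom_def using minus_mem by (metis minus_mult_commute minus_minus)

lemma sdom_diff: "x \<prec> z \<Longrightarrow> y \<prec> z \<Longrightarrow> x - y \<prec> z"
  using sdom_add[of z x "- y"] by simp

lemma sdom_sum: "z \<noteq> 0 \<Longrightarrow> (\<And>i. i \<in> I \<Longrightarrow> f i \<prec> z) \<Longrightarrow> (\<Sum>i\<in>I. f i) \<prec> z"
proof (induction I rule: infinite_finite_induct)
  case (insert i I)
  then show ?case using sdom_add[of z "f i" "\<Sum>i\<in>I. f i"] by simp
qed auto

lemma dom_mult: "x \<preceq> y \<Longrightarrow> x' \<preceq> y' \<Longrightarrow> x * x' \<preceq> y * y'"
  unfolding dom_def by clarify (rename_tac c d, rule_tac x = "c * d" in bexI, auto intro: mult_mem)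

lemma dom_mult_left_iff: "z \<noteq> 0 \<Longrightarrow> z * x \<preceq> z * y \<longleftrightarrow> x \<preceq> y"
  unfolding dom_def by (auto simp: mult.left_commute)

lemma dom_mult_right_iff: "z \<noteq> 0 \<Longrightarrow> x * z \<preceq> y * z \<longleftrightarrow> x \<preceq> y"
  using dom_mult_left_iff[of z x y] by (simp add: mult.commute)

lemma dom_mult_mem: "c \<preceq> 1 \<Longrightarrow> x \<preceq> y \<Longrightarrow> c * x \<preceq> y"
  using dom_mult[of c 1 x y] by simp

lemma dom_power: "x \<preceq> y \<Longrightarrow> x ^ n \<preceq> y ^ n"
  by (induction n) (auto intro: dom_mult)

lemma one_dom_power: "1 \<preceq> e \<Longrightarrow> 1 \<preceq> e ^ n"
  using dom_power[of 1 e n] by simp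

lemma power_dom_power: "1 \<preceq> e \<Longrightarrow> m \<le> n \<Longrightarrow> e ^ m \<preceq> e ^ n"
  using dom_mult[OF dom_refl[of "e ^ m"] one_dom_power[of e "n - m"]]
  by (simp flip: power_add)

text \<open>Ordered groups are torsion-free: if y \<prec> x, then all but one factor can be
  cancelled.\<close>

lemma dom_power_cancel:
  assumes "0 < n" "x ^ n \<preceq> y ^ n" shows "x \<preceq> y"
proof (rule ccontr)
  assume s: "\<not> x \<preceq> y"
  then have "x \<noteq> 0" by auto
  obtain m where n: "n = Suc m" using assms(1) gr0_implies_Suc by blast
  have "y \<preceq> x" using s by (rule sdom_imp_dom)
  then have "y ^ n \<preceq> x ^ m * y" unfolding n using dom_mult[OF dom_refl[of y] dom_power] 
    by (simp add: mult.commute)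
  then have "x ^ m * x \<preceq> x ^ m * y" using assms(2) dom_trans unfolding n by (simp add: mult.commute)
  then show False using s \<open>x \<noteq> 0\<close> dom_mult_left_iff[of "x ^ m"] by simp
qed

lemma dom_inverse_iff: "x \<noteq> 0 \<Longrightarrow> y \<noteq> 0 \<Longrightarrow> inverse x \<preceq> inverse y \<longleftrightarrow> y \<preceq> x"
  by (simp add: dom_divide_iff field_simps)

lemma of_nat_dom_one: "of_nat n \<preceq> 1"
  by (induction n) (auto intro: dom_add)

lemma equi_refl [simp]: "x \<asymp> x" by (simp add: equi_def)

lemma mem_max_ideal_iff: "x \<in> max_ideal \<O> \<longleftrightarrow> x \<prec> 1"
proof (cases "x = 0")
  case False
  then show ?thesis using inverse_mem[of "inverse x"]
    by (auto simp: max_ideal_def unit_group_def dom_divide_iff field_simps)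
qed (use zero_mem in \<open>auto simp: max_ideal_def unit_group_def\<close>)

lemma sdom_one_mult: "x \<prec> 1 \<Longrightarrow> y \<preceq> 1 \<Longrightarrow> x * y \<prec> 1"
  using dom_mult[of y 1 x x] dom_sdom_trans[of "x * y" x 1] by (simp add: mult.commute)

lemma one_add_equi: "x \<prec> 1 \<Longrightarrow> 1 + x \<asymp> 1"
proof -
  assume x: "x \<prec> 1"
  have "1 + x \<preceq> 1" using sdom_imp_dom[OF x] by (auto intro: dom_add)
  moreover have "1 \<preceq> 1 + x"
    using sdom_add[of "1" "1 + x" "- x"] x by auto
  ultimately show ?thesis by (simp add: equi_def)
qed

section \<open>Bounds for derivatives\<close>

lemma der_zero [simp]: "der 0 = 0"
  using der_add[of 0 0] by simp

lemma der_one [simp]: "der 1 = 0"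
  using der_mult[of 1 1] by simp

lemma der_minus: "der (- x) = - der x"
  by (rule minus_unique[symmetric]) (simp flip: der_add)

lemma der_diff: "der (x - y) = der x - der y"
  using der_add[of x "- y"] by (simp add: der_minus)

lemma der_of_nat [simp]: "der (of_nat n) = 0"
  by (induction n) (auto simp: der_add)

lemma der_inverse: "x \<noteq> 0 \<Longrightarrow> der (inverse x) = - der x * inverse x * inverse x"
proof -
  assume x: "x \<noteq> 0"
  have "x * der (inverse x) = - (der x * inverse x)"
    using der_mult[of x "inverse x"] x by (intro minus_unique[symmetric]) simp
  then have "inverse x * (x * der (inverse x)) = inverse x * - (der x * inverse x)" by simp
  then show ?thesis unfolding mult.assoc[symmetric] using x by (simp add: mult.commute)
qed

lemma der_power: "der (x ^ n) = of_nat n * x ^ (n - 1) * der x"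
proof (induction n)
  case (Suc n)
  then show ?case by (cases n) (auto simp: der_mult algebra_simps)
qed simp

lemma der_sdom_one: "x \<prec> 1 \<Longrightarrow> der x \<prec> 1"
  using der_small by (simp add: mem_max_ideal_iff)

text \<open>If x' were outside \<O>, then \<epsilon> = 1/x' and x\<epsilon> would be infinitesimal,
  yet (x\<epsilon>)' = 1 + x\<epsilon>' would be a unit.\<close>

lemma der_dom_one:
  assumes "x \<preceq> 1" shows "der x \<preceq> 1"
proof (rule ccontr)
  assume s: "\<not> der x \<preceq> 1"
  then have nz: "der x \<noteq> 0" by auto
  define \<epsilon> where "\<epsilon> = inverse (der x)"
  have \<epsilon>: "\<epsilon> \<prec> 1" using s dom_inverse_iff[of 1 "der x"] nz by (simp add: \<epsilon>_def)
  have "der (x * \<epsilon>) = 1 + x * der \<epsilon>" using nz by (simp add: der_mult \<epsilon>_def)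
  moreover have "der (x * \<epsilon>) \<prec> 1"
    using der_sdom_one sdom_one_mult[OF \<epsilon> assms] by (simp add: mult.commute)
  moreover have "x * der \<epsilon> \<prec> 1"
    using sdom_one_mult[OF der_sdom_one[OF \<epsilon>] assms] by (simp add: mult.commute)
  ultimately show False using one_add_equi[of "x * der \<epsilon>"] by (simp add: equi_def)
qed

lemma funpow_der_dom_one: "x \<preceq> 1 \<Longrightarrow> (der ^^ n) x \<preceq> 1"
  by (induction n) (auto intro: der_dom_one)

lemma funpow_der_sdom_one: "x \<prec> 1 \<Longrightarrow> (der ^^ n) x \<prec> 1"
  by (induction n) (use der_sdom_one in auto)

section \<open>Logarithmic derivatives and their values\<close>

definition ld :: "'k \<Rightarrow> 'k" where "ld x = der x / x"

lemma ld_mult: "x \<noteq> 0 \<Longrightarrow> y \<noteq> 0 \<Longrightarrow> ld (x * y) = ld x + ld y"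
  by (simp add: ld_def der_mult field_simps)

lemma ld_inverse: "x \<noteq> 0 \<Longrightarrow> ld (inverse x) = - ld x"
  by (simp add: ld_def der_inverse divide_inverse)

text \<open>The derivative of 1/e is - \<open>ld e\<close> / e, and it lies in \<O> because 1/e
  does.\<close>

lemma ld_dom_self:
  assumes "1 \<preceq> e" shows "ld e \<preceq> e"
proof -
  have nz: "e \<noteq> 0" using assms by auto
  have "inverse e \<preceq> 1" using assms dom_inverse_iff[of e 1] nz by simp
  then have "der (inverse e) \<preceq> 1" by (rule der_dom_one)
  then have "e * - der (inverse e) \<preceq> e * 1"
    by (intro dom_mult) auto
  moreover have "e * - der (inverse e) = ld e"
    using nz der_inverse[OF nz] by (simp add: ld_def divide_inverse)
  ultimately show ?thesis by (simp only: mult_1_right)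
qed

lemma der_dom:
  assumes "x \<preceq> e ^ n" "1 \<preceq> e" shows "der x \<preceq> e ^ Suc n"
proof -
  have nz: "e \<noteq> 0" using assms by auto
  obtain u where u: "u \<preceq> 1" "x = u * e ^ n" using assms(1) dom_one_iff by (auto simp: dom_def)
  have "of_nat n * e ^ (n - 1) * der e = of_nat n * ld e * e ^ n"
    using nz by (cases n) (auto simp: ld_def)
  then have "der x = der u * e ^ n + (u * of_nat n) * (ld e * e ^ n)"
    by (simp add: u(2) der_mult der_power mult_ac)
  moreover have "der u * e ^ n \<preceq> e ^ Suc n"
    using dom_mult_mem[OF der_dom_one[OF u(1)] power_dom_power[OF assms(2), of n "Suc n"]] by simp
  moreover have "(u * of_nat n) * (ld e * e ^ n) \<preceq> e ^ Suc n"
    using dom_mult[OF dom_mult[OF u(1) of_nat_dom_one] dom_mult[OF ld_dom_self[OF assms(2)] dom_refl]]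
    by simp
  ultimately show ?thesis by (auto intro: dom_add)
qed

text \<open>\<open>v (hgt x) = - \<bar>v x\<bar>\<close>.\<close>

definition hgt :: "'k \<Rightarrow> 'k" where
  "hgt x = (if 1 \<preceq> x then x else inverse x)"

lemma hgt_dom_iff:
  assumes "x \<noteq> 0" shows "hgt x \<preceq> y \<longleftrightarrow> x \<preceq> y \<and> inverse x \<preceq> y"
proof (cases "1 \<preceq> x")
  case True
  then have "inverse x \<preceq> 1" using dom_inverse_iff[of x 1] assms by simp
  then show ?thesis using True dom_trans[of "inverse x" x y] dom_trans[of "inverse x" 1 x]
    by (auto simp: hgt_def)
next
  case False
  then have "x \<preceq> 1" by (rule sdom_imp_dom)
  then have "1 \<preceq> inverse x" using dom_inverse_iff[of 1 x] assms by simp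
  then show ?thesis using False dom_trans[of x "inverse x" y] dom_trans[of x 1 "inverse x"]
      \<open>x \<preceq> 1\<close> by (auto simp: hgt_def)
qed

lemma dom_hgt: "x \<noteq> 0 \<Longrightarrow> x \<preceq> hgt x" and inverse_dom_hgt: "x \<noteq> 0 \<Longrightarrow> inverse x \<preceq> hgt x"
  using hgt_dom_iff[of x "hgt x"] by auto

lemma one_dom_hgt: "x \<noteq> 0 \<Longrightarrow> 1 \<preceq> hgt x"
  using dom_inverse_iff[of 1 x] dom_total[of 1 x] by (auto simp: hgt_def)

lemma hgt_mult: "x \<noteq> 0 \<Longrightarrow> y \<noteq> 0 \<Longrightarrow> hgt (x * y) \<preceq> hgt x * hgt y"
  by (simp add: hgt_dom_iff dom_hgt inverse_dom_hgt dom_mult)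

lemma hgt_inverse: "x \<noteq> 0 \<Longrightarrow> hgt (inverse x) \<preceq> hgt x"
  by (simp add: hgt_dom_iff dom_hgt inverse_dom_hgt)

text \<open>Gives \<open>v (ld g) = o(v g)\<close>, because \<open>g\<^bsup>(n)\<^esup>\<close> stays bounded together with \<open>g\<close>.\<close>

lemma funpow_der_asymptotics:
  assumes "g \<noteq> 0" "1 \<prec> ld g"
  shows "\<exists>\<eta>. \<eta> \<prec> 1 \<and> (der ^^ n) g = g * ld g ^ n * (1 + \<eta>)"
proof (induction n)
  case 0
  show ?case by (rule exI[of _ 0]) simp
next
  case (Suc n)
  define z where "z = ld g"
  have z: "1 \<prec> z" "z \<noteq> 0" using assms by (auto simp: z_def)
  have iz: "inverse z \<prec> 1" using z dom_inverse_iff[of 1 z] by simp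
  obtain \<eta> where \<eta>: "\<eta> \<prec> 1" "(der ^^ n) g = g * z ^ n * (1 + \<eta>)" using Suc z_def by blast
  \<comment> \<open>Dividing the derivative of \<open>g * z ^ n * (1 + \<eta>)\<close> by
    \<open>g * z ^ Suc n\<close> leaves 1 + \<eta> + n (z'/z^2) (1 + \<eta>) + \<eta>'/z, and z'/z^2
    is minus the derivative of the infinitesimal 1/z.\<close>
  define \<theta> where "\<theta> = \<eta> - der (inverse z) * (of_nat n * (1 + \<eta>)) + inverse z * der \<eta>"
  have "1 + \<eta> \<preceq> 1" using one_add_equi[OF \<eta>(1)] by (simp add: equi_def)
  then have "of_nat n * (1 + \<eta>) \<preceq> 1" by (intro dom_mult_mem of_nat_dom_one)
  then have "\<theta> \<prec> 1" unfolding \<theta>_def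
    by (intro sdom_add sdom_diff sdom_one_mult \<eta>(1) der_sdom_one iz der_dom_one sdom_imp_dom[OF \<eta>(1)])
  moreover have "(der ^^ Suc n) g = g * z ^ Suc n * (1 + \<theta>)"
  proof -
    have "der g = g * z" using assms by (simp add: z_def ld_def)
    moreover have "of_nat n * z ^ (n - 1) = of_nat n * z ^ n / z" using z by (cases n) auto
    ultimately have "der (g * z ^ n * (1 + \<eta>)) =
      g * z * z ^ n * (1 + \<eta>) + g * (of_nat n * z ^ n / z * der z) * (1 + \<eta>) + g * z ^ n * der \<eta>"
      by (simp add: der_mult der_power der_add algebra_simps add_divide_distrib)
    also have "\<dots> = g * z ^ Suc n * (1 + \<theta>)"
      unfolding \<theta>_def der_inverse[OF z(2)] using z(2) by (simp add: field_simps)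
    finally show ?thesis using \<eta>(2) by simp
  qed
  ultimately show ?case unfolding z_def by blast
qed

text \<open>Unless \<open>ld g\<close> lies in \<O>, \<open>g * ld g ^ n\<close> is the n-th
  derivative of g up to a unit, and that derivative stays in \<O>.\<close>

lemma ld_power_dom_inverse:
  assumes "g \<noteq> 0" "g \<preceq> 1" shows "ld g ^ n \<preceq> inverse g"
proof (cases "ld g \<preceq> 1")
  case True
  have "1 \<preceq> inverse g" using assms dom_inverse_iff[of 1 g] by simp
  then show ?thesis using dom_power[OF True, of n] dom_trans by simp
next
  case False
  then obtain \<eta> where \<eta>: "\<eta> \<prec> 1" "(der ^^ n) g = g * ld g ^ n * (1 + \<eta>)"
    using funpow_der_asymptotics assms by blast
  have "g * ld g ^ n * 1 \<preceq> g * ld g ^ n * (1 + \<eta>)"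
    using one_add_equi[OF \<eta>(1)] by (intro dom_mult) (auto simp: equi_def)
  also have "\<dots> \<preceq> 1" using funpow_der_dom_one[OF assms(2), of n] \<eta>(2) by simp
  finally have "g * ld g ^ n \<preceq> g * inverse g" using assms by simp
  then show ?thesis using assms dom_mult_left_iff by blast
qed

lemma ld_power_dom_hgt:
  assumes "g \<noteq> 0" shows "ld g ^ n \<preceq> hgt g"
proof (cases "g \<preceq> 1")
  case True
  then show ?thesis using ld_power_dom_inverse[OF assms] inverse_dom_hgt[OF assms] dom_trans by blast
next
  case False
  then have "inverse g \<preceq> 1" using dom_inverse_iff[of g 1] sdom_imp_dom assms by simp
  then have "ld (inverse g) ^ n \<preceq> g" using ld_power_dom_inverse[of "inverse g" n] assms by simp
  moreover have "ld (inverse g) ^ n = ld g ^ n \<or> ld (inverse g) ^ n = - (ld g ^ n)"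
    by (cases "even n") (auto simp: ld_inverse[OF assms])
  ultimately have "ld g ^ n \<preceq> g" by auto
  then show ?thesis using dom_hgt[OF assms] dom_trans by blast
qed

text \<open>Packages v(\<open>ld g\<close>) = o(v g). Taking E to be the larger of 1 and
  \<open>ld g\<close> makes the powers of E increase.\<close>

lemma ld_bound:
  assumes "g \<noteq> 0"
  obtains E where "1 \<preceq> E" "ld g \<preceq> E" "\<And>n. E ^ n \<preceq> hgt g"
  using ld_power_dom_hgt[OF assms] one_dom_hgt[OF assms] dom_total[of 1 "ld g"]
    that[of 1] that[of "ld g"] by auto

section \<open>Twisted operators and the Gauss norm\<close>

text \<open>A coefficient of least value, so that its value is vA; choosing an element instead of a
  value permits division.\<close>

definition gauss :: "'k poly \<Rightarrow> 'k" where
  "gauss A = coeff A (SOME i. \<forall>j. coeff A j \<preceq> coeff A i)"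

lemma ex_dominating:
  assumes "finite I" "I \<noteq> {}" shows "\<exists>i\<in>I. \<forall>j\<in>I. f j \<preceq> f i"
  using assms
proof (induction I rule: finite_ne_induct)
  case (insert k I)
  then obtain i where i: "i \<in> I" "\<forall>j\<in>I. f j \<preceq> f i" by blast
  show ?case
  proof (cases "f k \<preceq> f i")
    case False
    then have "f i \<preceq> f k" by (rule sdom_imp_dom)
    then show ?thesis using i dom_trans by auto
  qed (use i in auto)
qed simp

lemma coeff_dom_gauss: "coeff A j \<preceq> gauss A"
proof -
  obtain i where i: "i \<le> degree A" "\<forall>j\<le>degree A. coeff A j \<preceq> coeff A i"
    using ex_dominating[of "{..degree A}" "coeff A"] by auto
  have "coeff A j \<preceq> coeff A i" for j
    using i by (cases "j \<le> degree A") (auto simp: coeff_eq_0)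
  then have "\<exists>i. \<forall>j. coeff A j \<preceq> coeff A i" by blast
  then show ?thesis unfolding gauss_def by (rule someI2_ex) blast
qed

lemma gauss_dom_iff: "gauss A \<preceq> x \<longleftrightarrow> (\<forall>j. coeff A j \<preceq> x)"
  using coeff_dom_gauss dom_trans by (fastforce simp: gauss_def)

lemma gauss_sdom: "(\<And>j. coeff A j \<prec> x) \<Longrightarrow> gauss A \<prec> x"
  by (simp add: gauss_def)

lemma gauss_eq_zero_iff [simp]: "gauss A = 0 \<longleftrightarrow> A = 0"
  using gauss_dom_iff[of A 0] by (auto simp: poly_eq_iff)

lemma gauss_eq_coeff: "\<exists>i\<le>degree A. gauss A = coeff A i"
proof (cases "A = 0")
  case False
  then have "gauss A \<noteq> 0" by simp
  then show ?thesis using le_degree by (auto simp: gauss_def)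
qed auto

lemma gauss_smult: "gauss (smult c A) = c * gauss A"
  by (cases "c = 0") (simp_all add: gauss_def dom_mult_left_iff)

lemma smult_sum_right: "smult c (\<Sum>i\<in>I. f i) = (\<Sum>i\<in>I. smult c (f i))"
  for f :: "'b \<Rightarrow> 'k poly"
  by (induction I rule: infinite_finite_induct) (auto simp: smult_add_right)

text \<open>Left multiplication by the operator \<open>\<partial> + z\<close> in \<open>K[\<partial>]\<close>.\<close>

definition lop :: "'k \<Rightarrow> 'k poly \<Rightarrow> 'k poly" where
  "lop z P = map_poly der P + smult z P + pCons 0 P"

text \<open>As \<open>(lop z ^^ i) 1\<close> is the i-th power of \<partial> + z, this is the
  automorphism of K[\<partial>] over K that sends \<partial> to \<partial> + z.\<close>

definition twist :: "'k poly \<Rightarrow> 'k \<Rightarrow> 'k poly" where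
  "twist A z = (\<Sum>i\<le>degree A. smult (coeff A i) ((lop z ^^ i) 1))"

lemma coeff_lop:
  "coeff (lop z P) i = der (coeff P i) + z * coeff P i + (case i of 0 \<Rightarrow> 0 | Suc j \<Rightarrow> coeff P j)"
  by (simp add: lop_def coeff_map_poly coeff_pCons)

lemma lop_add: "lop z (P + Q) = lop z P + lop z Q"
  by (rule poly_eqI) (simp add: coeff_lop der_add algebra_simps split: nat.split)

lemma lop_zero [simp]: "lop z 0 = 0"
  by (simp add: lop_def)

lemma lop_sum: "lop z (\<Sum>i\<in>I. f i) = (\<Sum>i\<in>I. lop z (f i))"
  by (induction I rule: infinite_finite_induct) (auto simp: lop_add)

lemma lop_smult: "lop z (smult c P) = smult (der c) P + smult c (lop z P)"
  by (rule poly_eqI) (simp add: coeff_lop der_mult algebra_simps split: nat.split)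

lemma lop_shift: "lop (z + w) P = lop w P + smult z P"
  by (simp add: lop_def smult_add_left algebra_simps)

lemma twist_extend: "degree A \<le> n \<Longrightarrow> twist A z = (\<Sum>i\<le>n. smult (coeff A i) ((lop z ^^ i) 1))"
  unfolding twist_def by (rule sum.mono_neutral_left) (auto simp: coeff_eq_0)

lemma twist_add: "twist (A + B) z = twist A z + twist B z"
proof -
  define n where "n = max (degree A) (degree B)"
  have "degree (A + B) \<le> n" "degree A \<le> n" "degree B \<le> n"
    by (auto simp: n_def degree_add_le_max)
  then show ?thesis by (simp add: twist_extend smult_add_left sum.distrib)
qed

lemma twist_smult: "twist (smult c A) z = smult c (twist A z)"
  by (cases "c = 0") (simp_all add: twist_def smult_sum_right mult.commute)

lemma twist_sum: "twist (\<Sum>i\<in>I. f i) z = (\<Sum>i\<in>I. twist (f i) z)"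
  by (induction I rule: infinite_finite_induct) (auto simp: twist_add, auto simp: twist_def)

lemma degree_lop: "degree (lop z P) \<le> Suc (degree P)"
  by (rule degree_le) (auto simp: coeff_lop coeff_eq_0 split: nat.split)

lemma degree_lop_power: "degree ((lop z ^^ i) 1) \<le> i"
proof (induction i)
  case (Suc i)
  then show ?case using degree_lop[of z "(lop z ^^ i) 1"] by simp
qed simp

lemma degree_twist: "degree (twist A z) \<le> degree A"
  unfolding twist_def
proof (rule degree_sum_le)
  fix i assume "i \<in> {..degree A}"
  then show "degree (smult (coeff A i) ((lop z ^^ i) 1)) \<le> degree A"
    using degree_smult_le[of "coeff A i" "(lop z ^^ i) 1"] degree_lop_power[of i z] by simp
qed simp

text \<open>Multiplicativity of the automorphism for a left factor \<partial> + z. The sums run to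
  \<open>Suc n\<close> because that factor raises the order by one.\<close>

lemma twist_lop: "twist (lop z P) w = lop (z + w) (twist P w)"
proof -
  define n where "n = degree P"
  define L where "L i = (lop w ^^ i) 1" for i
  have "twist (lop z P) w = (\<Sum>i\<le>Suc n. smult (coeff (lop z P) i) (L i))"
    unfolding L_def n_def by (rule twist_extend) (rule degree_lop)
  also have "\<dots> = (\<Sum>i\<le>Suc n. smult (der (coeff P i)) (L i)) + (\<Sum>i\<le>Suc n. smult (z * coeff P i) (L i))
    + (\<Sum>i\<le>Suc n. smult (case i of 0 \<Rightarrow> 0 | Suc j \<Rightarrow> coeff P j) (L i))"
    by (simp only: coeff_lop smult_add_left sum.distrib)
  also have "(\<Sum>i\<le>Suc n. smult (case i of 0 \<Rightarrow> 0 | Suc j \<Rightarrow> coeff P j) (L i))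
    = (\<Sum>i\<le>n. smult (coeff P i) (L (Suc i)))"
    by (subst sum.atMost_Suc_shift) simp
  also have "(\<Sum>i\<le>Suc n. smult (der (coeff P i)) (L i)) = (\<Sum>i\<le>n. smult (der (coeff P i)) (L i))"
    by (simp add: n_def coeff_eq_0)
  also have "(\<Sum>i\<le>Suc n. smult (z * coeff P i) (L i)) = (\<Sum>i\<le>n. smult (z * coeff P i) (L i))"
    by (simp add: n_def coeff_eq_0)
  also have "(\<Sum>i\<le>n. smult (der (coeff P i)) (L i)) + (\<Sum>i\<le>n. smult (z * coeff P i) (L i))
     + (\<Sum>i\<le>n. smult (coeff P i) (L (Suc i))) = lop (z + w) (\<Sum>i\<le>n. smult (coeff P i) (L i))"
    by (simp add: lop_shift lop_sum lop_smult sum.distrib smult_sum_right smult_add_right mult.commute L_def)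
  finally show ?thesis by (simp add: twist_def n_def L_def)
qed

lemma twist_one [simp]: "twist 1 z = 1"
  by (simp add: twist_def)

text \<open>The automorphisms compose additively; in particular twisting by - z undoes twisting by
  z.\<close>

lemma twist_twist: "twist (twist A z) w = twist A (z + w)"
proof -
  have "twist ((lop z ^^ i) 1) w = (lop (z + w) ^^ i) 1" for i
    by (induction i) (simp_all add: twist_lop)
  then show ?thesis by (simp only: twist_def[of A] twist_sum twist_smult)
qed

lemma twist_zero: "twist A 0 = A"
proof -
  have "(lop 0 ^^ i) 1 = monom 1 i" for i
  proof (induction i)
    case (Suc i)
    have "lop 0 (monom 1 i) = monom 1 (Suc i)"
      by (rule poly_eqI) (simp add: coeff_lop coeff_monom split: nat.split)
    then show ?case using Suc by simp
  qed simp
  then show ?thesis unfolding twist_def by (simp add: smult_monom poly_as_sum_of_monoms)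
qed

lemma twist_eq_zero_iff [simp]: "twist A z = 0 \<longleftrightarrow> A = 0"
proof
  assume "twist A z = 0"
  then have "twist 0 (- z) = twist A 0" using twist_twist[of A z "- z"] by simp
  then show "A = 0" unfolding twist_zero by (simp add: twist_def)
qed (simp add: twist_def)

text \<open>Each factor \<partial> + z costs at most one factor e, whether it differentiates,
  multiplies by z or shifts.\<close>

lemma coeff_lop_power_dom:
  assumes "1 \<preceq> e" "z \<preceq> e" shows "coeff ((lop z ^^ i) 1) j \<preceq> e ^ i"
proof (induction i arbitrary: j)
  case (Suc i)
  let ?P = "(lop z ^^ i) 1"
  have 1: "der (coeff ?P j) \<preceq> e ^ Suc i" using der_dom[OF Suc assms(1)] .
  have 2: "z * coeff ?P j \<preceq> e ^ Suc i" using dom_mult[OF assms(2) Suc] by simp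
  have 3: "coeff ?P j \<preceq> e ^ Suc i" for j
    using dom_trans[OF Suc power_dom_power[OF assms(1), of i "Suc i"]] by simp
  show ?case using 1 2 3 by (auto simp: coeff_lop intro!: dom_add split: nat.split)
qed (auto simp: coeff_1)

lemma gauss_twist_dom:
  assumes "1 \<preceq> e" "z \<preceq> e" "degree A \<le> s" shows "gauss (twist A z) \<preceq> e ^ s * gauss A"
  unfolding gauss_dom_iff twist_def coeff_sum coeff_smult
proof (intro allI dom_sum)
  fix i j assume "i \<in> {..degree A}"
  then have "coeff ((lop z ^^ i) 1) j \<preceq> e ^ s"
    using dom_trans[OF coeff_lop_power_dom[OF assms(1,2)] power_dom_power[OF assms(1), of i s]] assms(3)
    by simp
  from dom_mult[OF this coeff_dom_gauss]
  show "coeff A i * coeff ((lop z ^^ i) 1) j \<preceq> e ^ s * gauss A" by (simp add: mult.commute)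
qed

text \<open>The bound from below is the bound from above for the inverse twist, which starts from an
  operator of no larger order.\<close>

lemma hgt_gauss_twist:
  assumes "1 \<preceq> e" "z \<preceq> e" "degree A \<le> s" "A \<noteq> 0"
  shows "hgt (gauss (twist A z) / gauss A) \<preceq> e ^ s"
proof -
  have "gauss (twist A z) \<preceq> e ^ s * gauss A" by (rule gauss_twist_dom) fact+
  moreover have "gauss (twist (twist A z) (- z)) \<preceq> e ^ s * gauss (twist A z)"
    using assms degree_twist[of A z] by (intro gauss_twist_dom) auto
  ultimately show ?thesis using assms(4)
    by (simp add: hgt_dom_iff twist_twist twist_zero dom_divide_iff field_simps)
       (simp add: dom_def field_simps)
qed

text \<open>Leibniz rule for the product \<partial>^i g in K[\<partial>]. For j > i the truncated
  \<open>i - j\<close> is harmless, since the binomial coefficient vanishes.\<close>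

lemma coeff_lop_power_const:
  "coeff ((lop 0 ^^ i) [:g:]) j = of_nat (i choose j) * (der ^^ (i - j)) g"
proof (induction i arbitrary: j)
  case 0
  show ?case by (cases j) auto
next
  case (Suc i)
  show ?case
  proof (cases j)
    case 0
    then show ?thesis using Suc[of 0] by (simp add: coeff_lop)
  next
    case j: (Suc m)
    show ?thesis
    proof (cases "Suc m \<le> i")
      case True
      then have "Suc (i - Suc m) = i - m" by simp
      then have "der ((der ^^ (i - Suc m)) g) = (der ^^ (i - m)) g"
        by (metis comp_apply funpow.simps(2))
      then show ?thesis by (simp add: j coeff_lop Suc der_mult algebra_simps)
    next
      case False
      then show ?thesis by (cases "m = i") (auto simp: j coeff_lop Suc der_mult binomial_eq_0)
    qed
  qed
qed

section \<open>Values of multiplicative conjugates\<close>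

lemma coeff_dop_times:
  "coeff (dop_times der A g) n = (\<Sum>i\<le>degree A. coeff A i * (of_nat (i choose n) * (der ^^ (i - n)) g))"
proof -
  have "(\<Sum>j\<le>i. if j = n then c j else 0) = (if n \<le> i then c n else 0)" for i and c :: "nat \<Rightarrow> 'k"
    by simp
  then show ?thesis
    by (auto simp: dop_times_def coeff_sum mult_ac intro!: sum.cong)
qed

text \<open>In K[\<partial>] one has \<partial> g = g (\<partial> + g'/g), so moving g to the left
  of A replaces \<partial> by \<partial> + \<open>ld g\<close>.\<close>

lemma dop_times_eq_twist:
  assumes "g \<noteq> 0" shows "dop_times der A g = smult g (twist A (ld g))"
proof -
  have shift: "lop 0 (smult g P) = smult g (lop (ld g) P)" for P
    using assms lop_shift[of "ld g" 0 P] by (simp add: lop_smult ld_def smult_add_right)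
  have "(lop 0 ^^ i) [:g:] = smult g ((lop (ld g) ^^ i) 1)" for i
    by (induction i) (auto simp: shift one_pCons)
  then have *: "of_nat (i choose n) * (der ^^ (i - n)) g = g * coeff ((lop (ld g) ^^ i) 1) n" for i n
    using coeff_lop_power_const[of i g n] by simp
  show ?thesis
    by (rule poly_eqI)
       (simp add: coeff_dop_times * twist_def coeff_sum sum_distrib_left mult.left_commute)
qed

lemma dop_times_zero [simp]: "dop_times der A 0 = 0"
proof -
  have "(der ^^ n) 0 = 0" for n by (induction n) auto
  then show ?thesis by (simp add: dop_times_def)
qed

lemma gauss_zero [simp]: "gauss 0 = 0"
  by simp

lemma dop_times_mult:
  assumes "g \<noteq> 0" "h \<noteq> 0" shows "dop_times der (dop_times der A g) h = dop_times der A (g * h)"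
  using assms by (simp add: dop_times_eq_twist twist_smult twist_twist ld_mult mult.commute)

lemma dop_times_eq_zero_iff: "g \<noteq> 0 \<Longrightarrow> dop_times der A g = 0 \<longleftrightarrow> A = 0"
  by (simp add: dop_times_eq_twist)

lemma gauss_dop_times_dom: "u \<preceq> 1 \<Longrightarrow> gauss (dop_times der A u) \<preceq> gauss A"
  unfolding gauss_dom_iff coeff_dop_times
proof (intro allI dom_sum)
  fix i n assume u: "u \<preceq> 1"
  show "coeff A i * (of_nat (i choose n) * (der ^^ (i - n)) u) \<preceq> gauss A"
    using dom_mult_mem[OF dom_mult_mem[OF of_nat_dom_one funpow_der_dom_one[OF u]] coeff_dom_gauss]
    by (metis mult.commute)
qed

lemma gauss_dop_times_sdom:
  assumes "u \<prec> 1" "A \<noteq> 0" shows "gauss (dop_times der A u) \<prec> gauss A"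
proof (rule gauss_sdom)
  fix n
  show "coeff (dop_times der A u) n \<prec> gauss A"
    unfolding coeff_dop_times
  proof (rule sdom_sum)
    fix i
    have "(der ^^ (i - n)) u * of_nat (i choose n) \<prec> 1"
      by (intro sdom_one_mult funpow_der_sdom_one assms of_nat_dom_one)
    then have "gauss A * (of_nat (i choose n) * (der ^^ (i - n)) u) \<prec> gauss A * 1"
      using assms by (subst dom_mult_left_iff) (auto simp: mult.commute)
    moreover have "coeff A i * (of_nat (i choose n) * (der ^^ (i - n)) u)
        \<preceq> gauss A * (of_nat (i choose n) * (der ^^ (i - n)) u)"
      by (rule dom_mult[OF coeff_dom_gauss dom_refl])
    ultimately show "coeff A i * (of_nat (i choose n) * (der ^^ (i - n)) u) \<prec> gauss A"
      using dom_trans by auto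
  qed (use assms in simp)
qed

text \<open>Pass from g to h by conjugating once more with h/g, which lies in \<O>. Hence
  v(A_\<times>g) depends only on v g.\<close>

lemma gauss_dop_times_mono:
  assumes "h \<preceq> g" shows "gauss (dop_times der A h) \<preceq> gauss (dop_times der A g)"
proof (cases "h = 0")
  case False
  then have "g \<noteq> 0" using assms by auto
  then have "h / g \<preceq> 1" using assms by (simp add: dom_divide_iff)
  from gauss_dop_times_dom[OF this, of "dop_times der A g"] show ?thesis
    using False \<open>g \<noteq> 0\<close> by (simp add: dop_times_mult)
qed simp

lemma gauss_dop_times_strict_mono:
  assumes "h \<prec> g" "A \<noteq> 0" shows "gauss (dop_times der A h) \<prec> gauss (dop_times der A g)"
proof (cases "h = 0")
  case True
  then show ?thesis using assms by (simp add: dop_times_eq_zero_iff)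
next
  case False
  have g: "g \<noteq> 0" using assms by auto
  have "h / g \<prec> 1"
  proof
    assume "1 \<preceq> h / g"
    then have "g * 1 \<preceq> g * (h / g)" using dom_mult_left_iff[OF g] by blast
    then show False using assms g by simp
  qed
  from gauss_dop_times_sdom[OF this, of "dop_times der A g"] show ?thesis
    using False g assms by (simp add: dop_times_mult dop_times_eq_zero_iff)
qed

lemma dop_times_one [simp]: "dop_times der A 1 = A"
  by (simp add: dop_times_eq_twist ld_def twist_zero)

lemma dop_apply_one: "dop_apply der A 1 = coeff A 0"
proof -
  have "(der ^^ i) 1 = (if i = 0 then 1 else 0)" for i by (induction i) auto
  then have "coeff A i * (der ^^ i) 1 = (if i = 0 then coeff A i else 0)" for i
    by (simp only: mult_1_right mult_zero_right split: if_split) simp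
  then show ?thesis by (simp add: dop_apply_def)
qed

text \<open>A(y) is A_\<times>y applied to 1, that is, the constant coefficient of
  A_\<times>y.\<close>

lemma dop_apply_dom: "dop_apply der A y \<preceq> gauss (dop_times der A y)"
  using coeff_dom_gauss[of "dop_times der A y" 0]
    dop_apply_dop_times[of der A y 1, OF der_add der_mult] by (simp add: dop_apply_one)


section \<open>The equalizer theorem for linear operators\<close>

lemma vle_val: "vle \<O> (val \<O> a) (val \<O> b) \<longleftrightarrow> b \<preceq> a"
  unfolding dom_def by (rule vle_val_iff) (auto intro: one_mem mult_mem)

lemma val_eq_iff: "val \<O> a = val \<O> b \<longleftrightarrow> a \<asymp> b"
proof
  assume "val \<O> a = val \<O> b"
  then show "a \<asymp> b" using vle_val[of a b] vle_val[of b a] vle_val[of a a] by (simp add: equi_def)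
next
  assume "a \<asymp> b"
  then show "val \<O> a = val \<O> b"
    by (intro vle_val_antisym) (auto simp: equi_def vle_val intro: one_mem mult_mem)
qed

lemma vless_val: "vless \<O> (val \<O> a) (val \<O> b) \<longleftrightarrow> b \<prec> a"
  unfolding vless_def vle_val val_eq_iff equi_def using dom_total by blast

lemma vball_val: "vball \<O> a (val \<O> c) = {b. b - a \<preceq> c}"
  by (simp add: vball_def vle_val)

lemma dop_val_eq: "dop_val \<O> A = val \<O> (gauss A)"
  unfolding dop_val_def
proof (rule the_equality)
  obtain i where "i \<le> degree A" "gauss A = coeff A i" using gauss_eq_coeff by blast
  then show "val \<O> (gauss A) \<in> (\<lambda>i. val \<O> (coeff A i)) ` {..degree A} \<and>
    (\<forall>i\<le>degree A. vle \<O> (val \<O> (gauss A)) (val \<O> (coeff A i)))"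
    using coeff_dom_gauss[of A] by (auto simp: vle_val)
  fix \<gamma> assume "\<gamma> \<in> (\<lambda>i. val \<O> (coeff A i)) ` {..degree A} \<and>
    (\<forall>i\<le>degree A. vle \<O> \<gamma> (val \<O> (coeff A i)))"
  then obtain j where j: "\<gamma> = val \<O> (coeff A j)" "\<forall>i\<le>degree A. coeff A i \<preceq> coeff A j"
    by (auto simp: vle_val)
  then have "gauss A \<preceq> coeff A j" using \<open>i \<le> degree A\<close> \<open>gauss A = coeff A i\<close> by simp
  then show "\<gamma> = val \<O> (gauss A)" using j by (simp add: val_eq_iff equi_def coeff_dom_gauss)
qed

text \<open>The hypothesis says that of any two balls one contains the centre of the other, so that
  they meet.\<close>

lemma spherically_complete_Inter:
  assumes "spherically_complete \<O>" "I \<noteq> {}"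
    and "\<And>i j. i \<in> I \<Longrightarrow> j \<in> I \<Longrightarrow> a j - a i \<preceq> r i \<or> a j - a i \<preceq> r j"
  shows "\<exists>z. \<forall>i\<in>I. z - a i \<preceq> r i"
proof -
  define \<B> where "\<B> = (\<lambda>i. vball \<O> (a i) (val \<O> (r i))) ` I"
  have "\<Inter>\<B> \<noteq> {}"
  proof (rule assms(1)[unfolded spherically_complete_def, rule_format], intro conjI ballI)
    fix B C assume "B \<in> \<B>" "C \<in> \<B>"
    then obtain i j where ij: "i \<in> I" "j \<in> I" "B = {b. b - a i \<preceq> r i}" "C = {b. b - a j \<preceq> r j}"
      by (auto simp: \<B>_def vball_val)
    from assms(3)[OF ij(1,2)] show "B \<inter> C \<noteq> {}"
    proof
      assume "a j - a i \<preceq> r i"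
      then have "a j \<in> B \<inter> C" using ij by simp
      then show ?thesis by blast
    next
      assume "a j - a i \<preceq> r j"
      then have "a i \<in> B \<inter> C" using ij dom_commute by simp
      then show ?thesis by blast
    qed
  qed (use assms(2) in \<open>auto simp: \<B>_def\<close>)
  then show ?thesis by (auto simp: \<B>_def vball_val)
qed

text \<open>Put \<open>D g = gauss (A\<^bsub>\<times>g\<^esub>) / f\<close>. Since \<open>ld h\<close> has value \<open>o(v h)\<close>, the value of \<open>D (g h) / D g\<close> is
  \<open>v h + o(v h)\<close>. Hence the balls around \<open>ld g\<close> of radius \<open>hgt (D g)\<close> intersect pairwise. A common
  point \<open>z\<close> approximates each \<open>ld g\<close> so well that \<open>v (gauss (A\<^bsub>\<times>g\<^esub>))\<close> differs from \<open>v g + v (gauss (twist A z))\<close>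
  only by \<open>o(v (D g))\<close>, which leaves no choice but \<open>v (D g) = 0\<close> if \<open>g = f / gauss (twist A z)\<close>.\<close>

theorem equalizer:
  assumes sc: "spherically_complete \<O>" and A: "A \<noteq> 0" and f: "f \<noteq> 0"
  shows "\<exists>g. g \<noteq> 0 \<and> gauss (dop_times der A g) \<asymp> f"
proof -
  define s where "s = degree A"
  define D where "D g = g * gauss (twist A (ld g)) / f" for g
  have D: "D g \<noteq> 0" if "g \<noteq> 0" for g using that A f by (simp add: D_def)
  have step: "\<exists>t. t \<noteq> 0 \<and> hgt t \<preceq> E ^ s \<and> D (g * h) = D g * h * t"
    if "g \<noteq> 0" "h \<noteq> 0" "1 \<preceq> E" "ld h \<preceq> E" for g h E
  proof (intro exI conjI)
    \<comment> \<open>Since \<open>ld\<close> is additive, passing from g to \<open>g * h\<close>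
      twists A further by \<open>ld h\<close>; t is the resulting change of the Gauss norm.\<close>
    let ?t = "gauss (twist (twist A (ld g)) (ld h)) / gauss (twist A (ld g))"
    show "?t \<noteq> 0" using A by simp
    show "hgt ?t \<preceq> E ^ s"
      using that A degree_twist[of A "ld g"] by (intro hgt_gauss_twist) (auto simp: s_def)
    show "D (g * h) = D g * h * ?t"
      using that A by (simp add: D_def ld_mult twist_twist)
  qed
  have near: "ld (g * h) - ld g \<preceq> hgt (D g)"
    if g: "g \<noteq> 0" and h: "h \<noteq> 0" and le: "hgt (D (g * h)) \<preceq> hgt (D g)" for g h
  proof -
    obtain E where E: "1 \<preceq> E" "ld h \<preceq> E" "\<And>n. E ^ n \<preceq> hgt h" using ld_bound[OF h] by blast
    obtain t where t: "t \<noteq> 0" "hgt t \<preceq> E ^ s" "D (g * h) = D g * h * t"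
      using step[OF g h E(1,2)] by blast
    have E0: "E \<noteq> 0" using E(1) by auto
    have "h = D (g * h) * inverse (D g) * inverse t"
      using t D[OF g] by (simp add: field_simps)
    moreover have "hgt (D (g * h) * inverse (D g) * inverse t)
        \<preceq> hgt (D (g * h)) * hgt (inverse (D g)) * hgt (inverse t)"
      using D g h t(1)
      by (intro dom_trans[OF hgt_mult] dom_mult[OF hgt_mult dom_refl]) auto
    moreover have "\<dots> \<preceq> hgt (D g) * hgt (D g) * E ^ s"
      using le D g t by (intro dom_mult dom_trans[OF hgt_inverse]) auto
    ultimately have "hgt h \<preceq> hgt (D g) * hgt (D g) * E ^ s"
      using dom_trans by metis
    \<comment> \<open>In the exponent, s cancels the bound for t and 2 matches the two factors
      \<open>hgt (D g)\<close>, leaving E itself inside the radius.\<close>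
    then have "E ^ (2 + s) \<preceq> hgt (D g) * hgt (D g) * E ^ s" using E(3) dom_trans by blast
    then have "E ^ 2 \<preceq> hgt (D g) ^ 2"
      using E0 dom_mult_right_iff[of "E ^ s"] by (simp only: power_add power2_eq_square) simp
    then have "E \<preceq> hgt (D g)" by (rule dom_power_cancel[rotated]) simp
    then show ?thesis using E(2) dom_trans g h by (auto simp: ld_mult)
  qed
  have "\<exists>z. \<forall>g\<in>- {0}. z - ld g \<preceq> hgt (D g)"
  proof (rule spherically_complete_Inter[OF sc])
    fix g h :: 'k assume gh: "g \<in> - {0}" "h \<in> - {0}"
    \<comment> \<open>\<open>near\<close> is applied at the element whose ball has the larger
      radius.\<close>
    from dom_total[of "hgt (D g)" "hgt (D h)"] show "ld h - ld g \<preceq> hgt (D g) \<or> ld h - ld g \<preceq> hgt (D h)"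
      using near[of g "h / g"] near[of h "g / h"] gh dom_commute[of "ld g" "ld h"] by auto
  qed (use one_neq_zero in blast)
  then obtain z where z: "\<And>g. g \<noteq> 0 \<Longrightarrow> z - ld g \<preceq> hgt (D g)" by auto
  define g where "g = f / gauss (twist A z)"
  have g: "g \<noteq> 0" using f A by (simp add: g_def)
  \<comment> \<open>At g the ball only gives the error \<open>hgt (D g)\<close>, which is too
    coarse. Moving by this h yields \<open>D (g * h) = t\<close>, so z approximates
    \<open>ld (g * h)\<close> up to \<open>E ^ s\<close>; as \<open>ld h\<close> is bounded by E,
    this controls \<open>ld g - z\<close> by a power of E.\<close>
  define h where "h = inverse (D g)"
  have h: "h \<noteq> 0" using D[OF g] by (simp add: h_def)
  obtain E where E: "1 \<preceq> E" "ld h \<preceq> E" "\<And>n. E ^ n \<preceq> hgt h" using ld_bound[OF h] by blast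
  have E': "E ^ n \<preceq> hgt (D g)" for n
    using dom_trans[OF E(3) hgt_inverse[OF D[OF g], folded h_def]] .
  obtain t where t: "t \<noteq> 0" "hgt t \<preceq> E ^ s" "D (g * h) = D g * h * t"
    using step[OF g h E(1,2)] by blast
  have "D (g * h) = t" using t D[OF g] by (simp add: h_def)
  then have "z - ld (g * h) \<preceq> E ^ s" using z[of "g * h"] g h t(2) dom_trans by auto
  moreover have "E ^ s \<preceq> E ^ Suc s" "E ^ 1 \<preceq> E ^ Suc s" by (intro power_dom_power E(1), simp)+
  ultimately have "ld (g * h) - z \<preceq> E ^ Suc s" "ld h \<preceq> E ^ Suc s"
    using E(2) dom_trans[of "z - ld (g * h)" "E ^ s" "E ^ Suc s"] dom_trans[of "ld h" E "E ^ Suc s"]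
    by (simp_all add: dom_commute[of z])
  then have "ld (g * h) - z - ld h \<preceq> E ^ Suc s" by (rule dom_diff)
  then have "ld g - z \<preceq> E ^ Suc s" using g h by (simp add: ld_mult)
  then have "hgt (gauss (twist (twist A z) (ld g - z)) / gauss (twist A z)) \<preceq> (E ^ Suc s) ^ s"
    using A degree_twist[of A z] by (intro hgt_gauss_twist one_dom_power E(1)) (auto simp: s_def)
  then have "hgt (D g) \<preceq> (E ^ Suc s) ^ s"
    using f by (simp add: D_def twist_twist) (simp add: g_def)
  then have *: "hgt (D g) \<preceq> E ^ (Suc s * s)" by (simp only: power_mult)
  \<comment> \<open>Every power of E is below \<open>hgt (D g)\<close>, which itself is below one
    fixed power of E; comparison with the next power forces E \<preceq> 1.\<close>
  then have "E * E ^ (Suc s * s) \<preceq> 1 * E ^ (Suc s * s)"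
    using E'[of "Suc (Suc s * s)"] dom_trans by simp
  moreover have "E ^ (Suc s * s) \<noteq> 0" using E(1) by auto
  ultimately have "E \<preceq> 1" using dom_mult_right_iff[of "E ^ (Suc s * s)" E 1] by blast
  then have "hgt (D g) \<preceq> 1" using * dom_power[of E 1] dom_trans by auto
  then have "D g \<asymp> 1"
    using hgt_dom_iff[OF D[OF g]] dom_inverse_iff[of "D g" 1] D[OF g] by (simp add: equi_def)
  then have "f * D g \<asymp> f * 1" unfolding equi_def dom_mult_left_iff[OF f] .
  then have "gauss (dop_times der A g) \<asymp> f"
    using f g by (simp add: D_def dop_times_eq_twist gauss_smult)
  then show ?thesis using g by blast
qed

section \<open>Lifting solutions from the differential residue field\<close>

definition res :: "'k \<Rightarrow> 'k set" where
  "res x = max_ideal \<O> +>\<^bsub>val_ring \<O>\<^esub> x"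

lemma carrier_val_ring [simp]: "carrier (val_ring \<O>) = \<O>"
  and add_val_ring [simp]: "x \<oplus>\<^bsub>val_ring \<O>\<^esub> y = x + y"
  and mult_val_ring [simp]: "x \<otimes>\<^bsub>val_ring \<O>\<^esub> y = x * y"
  and zero_val_ring [simp]: "\<zero>\<^bsub>val_ring \<O>\<^esub> = 0"
  and one_val_ring [simp]: "\<one>\<^bsub>val_ring \<O>\<^esub> = 1"
  by (simp_all add: val_ring_def)

lemma cring_val_ring: "cring (val_ring \<O>)"
proof (rule cringI)
  show "abelian_group (val_ring \<O>)"
    by (rule abelian_groupI)
       (auto simp: add_mem zero_mem algebra_simps intro!: bexI[of _ "- _"] minus_mem)
  show "comm_monoid (val_ring \<O>)"
    by (rule comm_monoidI) (auto simp: mult_mem one_mem algebra_simps)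
qed (auto simp: algebra_simps)

lemma ideal_max_ideal: "ideal (max_ideal \<O>) (val_ring \<O>)"
proof (rule idealI)
  interpret cring "val_ring \<O>" by (rule cring_val_ring)
  have sub: "x \<in> \<O>" if "x \<in> max_ideal \<O>" for x
    using that by (simp add: max_ideal_def)
  show "ring (val_ring \<O>)" ..
  show "subgroup (max_ideal \<O>) (add_monoid (val_ring \<O>))"
  proof (rule add.subgroupI)
    fix x assume x: "x \<in> max_ideal \<O>"
    have "\<ominus>\<^bsub>val_ring \<O>\<^esub> x = - x"
      using sub[OF x] minus_mem by (intro minus_equality) auto
    then show "\<ominus>\<^bsub>val_ring \<O>\<^esub> x \<in> max_ideal \<O>"
      using x by (simp add: mem_max_ideal_iff)
  next
    have "0 \<in> max_ideal \<O>" by (simp add: mem_max_ideal_iff)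
    then show "max_ideal \<O> \<noteq> {}" by blast
  qed (auto simp: sub mem_max_ideal_iff sdom_add)
qed (auto simp: mem_max_ideal_iff sdom_one_mult dom_one_iff mult.commute)

lemma mem_res_iff: "y \<in> res x \<longleftrightarrow> y - x \<prec> 1"
  unfolding res_def a_r_coset_def' by (force simp: mem_max_ideal_iff)

lemma res_eq_iff: "res x = res y \<longleftrightarrow> x - y \<prec> 1"
proof
  assume "res x = res y"
  moreover have "x \<in> res x" by (simp add: mem_res_iff)
  ultimately show "x - y \<prec> 1" by (simp add: mem_res_iff)
next
  assume xy: "x - y \<prec> 1"
  have "z - x \<prec> 1 \<longleftrightarrow> z - y \<prec> 1" for z
    using sdom_add[of 1 "z - x" "x - y"] sdom_diff[of 1 "z - y" "x - y"] xy by auto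
  then show "res x = res y" by (auto simp: mem_res_iff)
qed

lemma carrier_residue_field: "carrier (residue_field \<O>) = res ` \<O>"
  by (auto simp: residue_field_def FactRing_def A_RCOSETS_def' res_def)

lemma res_hom: "res \<in> ring_hom (val_ring \<O>) (residue_field \<O>)"
  using ideal.rcos_ring_hom[OF ideal_max_ideal]
  by (simp add: residue_field_def res_def[abs_def])

lemma res_mult: "x \<in> \<O> \<Longrightarrow> y \<in> \<O> \<Longrightarrow> res x \<otimes>\<^bsub>residue_field \<O>\<^esub> res y = res (x * y)"
  and res_add: "x \<in> \<O> \<Longrightarrow> y \<in> \<O> \<Longrightarrow> res x \<oplus>\<^bsub>residue_field \<O>\<^esub> res y = res (x + y)"
  using ring_hom_mult[OF res_hom] ring_hom_add[OF res_hom] by auto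

lemma cring_residue_field: "cring (residue_field \<O>)"
  unfolding residue_field_def
  by (rule ideal.quotient_is_cring[OF ideal_max_ideal cring_val_ring])

lemma zero_residue_field: "\<zero>\<^bsub>residue_field \<O>\<^esub> = res 0"
  using ring_hom_zero[OF res_hom] cring_val_ring cring_residue_field by (simp add: cring_def)

lemma residue_derivation_res: "residue_derivation \<O> der (res x) = res (der x)"
proof -
  have "res (der y) = res (der x)" if "y \<in> res x" for y
    using that der_sdom_one[of "y - x"] by (simp add: mem_res_iff res_eq_iff der_diff)
  moreover have "x \<in> res x" by (simp add: mem_res_iff)
  ultimately show ?thesis unfolding residue_derivation_def res_def[symmetric] by blast
qed

lemma residue_derivation_funpow_res:
  "(residue_derivation \<O> der ^^ i) (res x) = res ((der ^^ i) x)"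
  by (induction i) (simp_all add: residue_derivation_res)

lemma finsum_res:
  assumes "\<And>i. i \<le> s \<Longrightarrow> f i \<in> \<O>"
  shows "(\<Oplus>\<^bsub>residue_field \<O>\<^esub>i\<in>{..s::nat}. res (f i)) = res (\<Sum>i\<le>s. f i)"
proof -
  interpret cring "residue_field \<O>" by (rule cring_residue_field)
  show ?thesis using assms
  proof (induction s)
    case 0
    then show ?case by (simp add: Pi_def carrier_residue_field)
  next
    case (Suc s)
    have "(\<Sum>i\<le>s. f i) \<in> \<O>"
      using dom_sum[of "{..s}" f 1] Suc.prems by (simp add: dom_one_iff)
    moreover have "(\<Oplus>\<^bsub>residue_field \<O>\<^esub>i\<in>{..Suc s}. res (f i))
        = res (f (Suc s)) \<oplus>\<^bsub>residue_field \<O>\<^esub> (\<Oplus>\<^bsub>residue_field \<O>\<^esub>i\<in>{..s}. res (f i))"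
      using Suc.prems by (intro finsum_Suc) (auto simp: carrier_residue_field)
    ultimately show ?case using Suc by (simp add: res_add add.commute)
  qed
qed

text \<open>The coefficients lie in \<O> and one of them is a unit, so reduction gives a nonzero
  operator, possibly of lower order. Any lift of a solution over the residue field is a solution up
  to an infinitesimal.\<close>

lemma linearly_surjective_lift:
  assumes ls: "linearly_surjective (residue_field \<O>) (residue_derivation \<O> der)"
    and A: "gauss A \<asymp> 1" and b: "b \<preceq> 1"
  shows "\<exists>u. u \<preceq> 1 \<and> dop_apply der A u - b \<prec> 1"
proof -
  have mem: "coeff A i \<in> \<O>" for i
    using A dom_trans[OF coeff_dom_gauss, of A 1 i] by (simp add: equi_def dom_one_iff)
  obtain i where i: "i \<le> degree A" "gauss A = coeff A i" using gauss_eq_coeff by blast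
  have "\<forall>i\<le>degree A. res (coeff A i) \<in> carrier (residue_field \<O>)"
    by (simp add: mem carrier_residue_field)
  moreover have "res (coeff A i) \<noteq> \<zero>\<^bsub>residue_field \<O>\<^esub>"
    using A i by (simp add: zero_residue_field res_eq_iff equi_def)
  moreover have "res b \<in> carrier (residue_field \<O>)"
    using b by (simp add: carrier_residue_field dom_one_iff)
  ultimately obtain y where y: "y \<in> carrier (residue_field \<O>)"
    "(\<Oplus>\<^bsub>residue_field \<O>\<^esub>i\<in>{..degree A}.
        res (coeff A i) \<otimes>\<^bsub>residue_field \<O>\<^esub> (residue_derivation \<O> der ^^ i) y) = res b"
    using ls[unfolded linearly_surjective_def, rule_format, of "degree A" "\<lambda>i. res (coeff A i)" "res b"]
      i(1) by blast
  then obtain u where u: "u \<in> \<O>" "y = res u" by (auto simp: carrier_residue_field)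
  have du: "(der ^^ i) u \<in> \<O>" for i
    using funpow_der_dom_one[of u i] u(1) by (simp add: dom_one_iff)
  have "res (dop_apply der A u) = res b"
    using y(2) unfolding u(2) residue_derivation_funpow_res
    by (simp add: res_mult mem du finsum_res mult_mem dop_apply_def)
  then show ?thesis using u(1) by (auto simp: res_eq_iff dom_one_iff)
qed


section \<open>Zeros of linearly approximated functions\<close>

lemma dop_apply_smult: "dop_apply der (smult c A) y = c * dop_apply der A y"
  by (cases "c = 0") (simp_all add: dop_apply_def sum_distrib_left mult.assoc)

text \<open>Partial solutions are ordered by \<open>a < b\<close> iff \<open>b - a \<preceq> \<rho> a\<close> and \<open>R b \<prec> R a\<close>, where \<open>\<rho> a\<close> is the
  distance from \<open>a\<close> at which the linear part of \<open>R\<close> reaches the size of \<open>R a\<close>. Pseudolimits bound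
  chains, and lifting a solution of a linear equation from the residue field improves \<open>a\<close> if \<open>R a \<noteq> 0\<close>.\<close>

theorem linearly_approximated_zero:
  fixes R :: "'k \<Rightarrow> 'k"
  assumes ls: "linearly_surjective (residue_field \<O>) (residue_derivation \<O> der)"
    and sc: "spherically_complete \<O>"
    and A: "A \<noteq> 0" and R0: "R 0 \<prec> gauss A"
    and approx: "\<And>a b. a \<prec> 1 \<Longrightarrow> b \<prec> 1 \<Longrightarrow> a \<noteq> b \<Longrightarrow>
      R b - R a - dop_apply der A (b - a) \<prec> gauss (dop_times der A (b - a))"
  shows "\<exists>\<epsilon>. \<epsilon> \<prec> 1 \<and> R \<epsilon> = 0 \<and> gauss (dop_times der A \<epsilon>) \<preceq> R 0"
proof -
  \<comment> \<open>Where \<open>R a\<close> vanishes the scale is 0, which fits because A_\<times>0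
    is the zero operator.\<close>
  have "\<exists>r. gauss (dop_times der A r) \<asymp> R a" for a
    using equalizer[OF sc A, of "R a"] by (cases "R a = 0") (auto intro: exI[of _ 0])
  then obtain \<rho> where \<rho>: "\<And>a. gauss (dop_times der A (\<rho> a)) \<asymp> R a" by metis
  have ball: "gauss (dop_times der A h) \<preceq> R a" if "h \<preceq> \<rho> a" for a h
    using dom_trans[OF gauss_dop_times_mono[OF that] ] \<rho>[of a] by (simp add: equi_def)
  have \<rho>_mono: "\<rho> b \<preceq> \<rho> a" if "R b \<preceq> R a" for a b
  proof (rule ccontr)
    assume "\<not> \<rho> b \<preceq> \<rho> a"
    then have "gauss (dop_times der A (\<rho> a)) \<prec> gauss (dop_times der A (\<rho> b))"
      by (rule gauss_dop_times_strict_mono) (rule A)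
    moreover have "gauss (dop_times der A (\<rho> b)) \<preceq> gauss (dop_times der A (\<rho> a))"
      using \<rho>[of a] \<rho>[of b] that dom_trans unfolding equi_def by metis
    ultimately show False by blast
  qed
  \<comment> \<open>The strict bound on \<open>R 0\<close> keeps the balls infinitesimal: if 1
    \<preceq> h, then A = A_\<times>1 would have Gauss norm \<preceq> \<open>R a\<close>.\<close>
  have \<rho>_small: "h \<prec> 1" if "R a \<preceq> R 0" "h \<preceq> \<rho> a" for a h
  proof
    assume "1 \<preceq> h"
    then have "gauss A \<preceq> R a"
      using ball[OF that(2)] gauss_dop_times_mono[of 1 h A] dom_trans by simp
    then show False using that(1) R0 dom_trans by blast
  qed
  have diff: "R b \<preceq> R a" if "a \<prec> 1" "b \<prec> 1" "b - a \<preceq> \<rho> a" for a b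
  proof (cases "a = b")
    case False
    have "R b = R a + dop_apply der A (b - a) + (R b - R a - dop_apply der A (b - a))" by simp
    moreover have "R b - R a - dop_apply der A (b - a) \<preceq> R a"
      using sdom_imp_dom[OF approx[OF that(1,2) False]] ball[OF that(3)] dom_trans by blast
    moreover have "dop_apply der A (b - a) \<preceq> R a"
      using dop_apply_dom ball[OF that(3)] dom_trans by blast
    ultimately show ?thesis using dom_add dom_refl by metis
  qed simp
  \<comment> \<open>The condition \<open>a \<preceq> \<rho> 0\<close> is what yields the final bound
    on the value of A_\<times>\<epsilon>.\<close>
  define X where "X = {a. a \<prec> 1 \<and> R a \<preceq> R 0 \<and> a \<preceq> \<rho> 0}"
  define P where "P a b \<longleftrightarrow> a = b \<or> b - a \<preceq> \<rho> a \<and> R b \<prec> R a" for a b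
  have in_X: "b \<in> X" if "a \<in> X" "b - a \<preceq> \<rho> a" for a b
  proof -
    have a: "a \<prec> 1" "R a \<preceq> R 0" "a \<preceq> \<rho> 0" using that(1) by (auto simp: X_def)
    have b: "b \<prec> 1" using sdom_add[OF a(1) \<rho>_small[OF a(2) that(2)]] by simp
    moreover have "b \<preceq> \<rho> 0"
      using dom_add[OF a(3) dom_trans[OF that(2) \<rho>_mono[OF a(2)]]] by simp
    ultimately show ?thesis
      using diff[OF a(1) b that(2)] a(2) dom_trans by (auto simp: X_def)
  qed
  have "\<exists>m\<in>X. \<forall>a\<in>X. P m a \<longrightarrow> a = m"
  proof (rule predicate_Zorn)
    show "partial_order_on X (relation_of P X)"
    proof (rule partial_order_on_relation_ofI)
      fix a b c assume "P a b" "P b c"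
      moreover have "c - a \<preceq> \<rho> a \<and> R c \<prec> R a"
        if *: "b - a \<preceq> \<rho> a" "R b \<prec> R a" "c - b \<preceq> \<rho> b" "R c \<prec> R b"
      proof
        have "R b \<preceq> R a" using *(2) by (rule sdom_imp_dom)
        then have "c - b \<preceq> \<rho> a" using \<rho>_mono *(3) dom_trans by blast
        from dom_add[OF *(1) this] show "c - a \<preceq> \<rho> a" by simp
        show "R c \<prec> R a" using *(4) sdom_dom_trans \<open>R b \<preceq> R a\<close> by blast
      qed
      ultimately show "P a c" unfolding P_def by blast
    next
      fix a b assume "P a b" "P b a"
      then show "a = b" unfolding P_def using sdom_imp_dom by blast
    qed (simp add: P_def)
  next
    fix C assume C: "C \<in> Chains (relation_of P X)"
    have CX: "C \<subseteq> X" by (rule Chains_relation_of[OF C])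
    have total: "P a b \<or> P b a" if "a \<in> C" "b \<in> C" for a b
      using C that by (auto simp: Chains_def relation_of_def)
    show "\<exists>u\<in>X. \<forall>a\<in>C. P a u"
    proof (cases "\<exists>m\<in>C. \<forall>a\<in>C. P a m")
      case True
      then show ?thesis using CX by blast
    next
      case no_max: False
      show ?thesis
      proof (cases "C = {}")
        case True
        have "0 \<in> X" by (simp add: X_def)
        then show ?thesis using True by blast
      next
        case False
        have "\<exists>z. \<forall>a\<in>C. z - a \<preceq> \<rho> a"
          using total dom_commute by (intro spherically_complete_Inter[OF sc False]) (fastforce simp: P_def)
        then obtain z where z: "\<And>a. a \<in> C \<Longrightarrow> z - a \<preceq> \<rho> a" by blast
        have zX: "z \<in> X" using False CX z in_X by blast
        have "P a z" if a: "a \<in> C" for a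
        proof -
          \<comment> \<open>As the chain has no last element, some b lies beyond a; the strict drop
            from \<open>R a\<close> to \<open>R b\<close> is inherited by
            \<open>R z\<close>.\<close>
          obtain b where b: "b \<in> C" "\<not> P b a" using no_max a by blast
          then have "R b \<prec> R a" using total[OF a b(1)] by (auto simp: P_def)
          moreover have "R z \<preceq> R b"
            using diff z[OF b(1)] zX b(1) CX by (auto simp: X_def)
          ultimately have "R z \<prec> R a" using dom_sdom_trans by blast
          then show ?thesis using z[OF a] by (simp add: P_def)
        qed
        then show ?thesis using zX by blast
      qed
    qed
  qed
  then obtain m where m: "m \<in> X" "\<And>a. a \<in> X \<Longrightarrow> P m a \<Longrightarrow> a = m" by blast
  have "R m = 0"
  proof (rule ccontr)
    assume f: "R m \<noteq> 0"
    \<comment> \<open>Newton step: A conjugated by the scale at m and divided by \<open>R m\<close>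
      has Gauss norm \<asymp> 1. Solving C(u) = - 1 up to an infinitesimal makes
      \<open>h = \<rho> m * u\<close> cancel \<open>R m\<close> up to a smaller error, and u
      \<preceq> 1 keeps \<open>m + h\<close> in the ball.\<close>
    define C where "C = smult (inverse (R m)) (dop_times der A (\<rho> m))"
    have "inverse (R m) * gauss (dop_times der A (\<rho> m)) \<asymp> inverse (R m) * R m"
      using \<rho>[of m] f by (simp add: equi_def dom_mult_left_iff del: left_inverse)
    then have "gauss C \<asymp> 1" using f by (simp add: C_def gauss_smult)
    from linearly_surjective_lift[OF ls this, of "- 1"]
    obtain u where u: "u \<preceq> 1" "dop_apply der C u + 1 \<prec> 1" by auto
    define h where "h = \<rho> m * u"
    have "dop_apply der C u = inverse (R m) * dop_apply der A h"
      by (simp add: C_def h_def dop_apply_smult dop_apply_dop_times[OF der_add der_mult])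
    then have "R m * (dop_apply der C u + 1) = dop_apply der A h + R m"
      using f by (simp add: field_simps)
    then have Ah: "dop_apply der A h + R m \<prec> R m"
      using u(2) dom_mult_left_iff[OF f, of 1 "dop_apply der C u + 1"] by simp
    have h: "h \<preceq> \<rho> m" using dom_mult_mem[OF u(1) dom_refl, of "\<rho> m"] by (simp add: h_def mult.commute)
    have h0: "h \<noteq> 0"
    proof
      assume "h = 0"
      then have "dop_apply der A h = 0" using dop_apply_dom[of A 0] by simp
      then show False using Ah by simp
    qed
    have mh: "m + h \<in> X" using in_X[OF m(1), of "m + h"] h by simp
    have "R (m + h) - R m - dop_apply der A h \<prec> R m"
    proof (rule sdom_dom_trans[OF _ ball[OF h]])
      have "m \<prec> 1" "m + h \<prec> 1" using m(1) mh by (simp_all add: X_def)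
      from approx[OF this] h0
      show "R (m + h) - R m - dop_apply der A h \<prec> gauss (dop_times der A h)" by simp
    qed
    from sdom_add[OF this Ah] have "R (m + h) \<prec> R m" by simp
    then have "P m (m + h)" using h by (simp add: P_def)
    then show False using m(2)[OF mh] h0 by simp
  qed
  then show ?thesis using m(1) ball[of m 0] by (auto simp: X_def)
qed

end

section \<open>The valued differential field of a model\<close>

lemma expansion_simps [simp]:
  "carrier (expansion \<F> \<R>) = UNIV"
  "x \<oplus>\<^bsub>expansion \<F> \<R>\<^esub> y = x + y" "x \<otimes>\<^bsub>expansion \<F> \<R>\<^esub> y = x * y"
  "\<zero>\<^bsub>expansion \<F> \<R>\<^esub> = 0" "\<one>\<^bsub>expansion \<F> \<R>\<^esub> = 1"
  "lt (expansion \<F> \<R>) x y \<longleftrightarrow> x < y"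
  by (simp_all add: expansion_def)

text \<open>In the formula for the graph, variables below n are the arguments and variable n is the
  value. No free variable is left for a parameter, so the default 0 is never read.\<close>

lemma definable_fun_UNIV:
  assumes "wf_fm L \<phi>" "fv \<phi> \<subseteq> {..n}"
    and "\<And>xs. length xs = Suc n \<Longrightarrow>
      sat (expansion \<F> \<R>) (\<lambda>i. if i < Suc n then xs ! i else 0) \<phi> \<longleftrightarrow> xs ! n = F (take n xs)"
  shows "definable_fun L (expansion \<F> \<R>) {} n {xs. length xs = n} F"
proof -
  have "{xs @ [F xs] | xs. length xs = n} = {xs. length xs = Suc n \<and> xs ! n = F (take n xs)}"
  proof (intro equalityI subsetI)
    fix xs assume xs: "xs \<in> {xs. length xs = Suc n \<and> xs ! n = F (take n xs)}"
    then have "xs = take n xs @ [F (take n xs)]"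
      using take_Suc_conv_app_nth[of n xs] by simp
    then show "xs \<in> {xs @ [F xs] | xs. length xs = n}" using xs by fastforce
  qed (auto simp: nth_append)
  then have "{xs @ [F xs] | xs. xs \<in> {xs. length xs = n}} = {xs. length xs = Suc n \<and>
      set xs \<subseteq> carrier (expansion \<F> \<R>) \<and>
      sat (expansion \<F> \<R>) (\<lambda>i. if i < Suc n then xs ! i else 0) \<phi>}"
    using assms(3) by auto
  then show ?thesis unfolding definable_fun_def definable_def using assms(1,2) by fastforce
qed

lemma definable_fun1_UNIV:
  fixes f :: "'a \<Rightarrow> 'a"
  assumes "definable_fun L M {} 1 {xs. length xs = 1} (\<lambda>xs. f (hd xs))"
  shows "definable_fun1 L M {} UNIV f"
proof -
  have *: "{[x] | x. x \<in> UNIV} = {xs :: 'a list. length xs = 1}"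
    by (auto simp: length_Suc_conv)
  show ?thesis unfolding definable_fun1_def * by (rule assms)
qed

lemma hd_two: "length xs = Suc (Suc 0) \<Longrightarrow> hd xs = xs ! 0"
  by (cases xs) auto

text \<open>Closure is given for unary functions, so the ring operations come from 1, negation,
  doubling and squaring by convexity: x + y lies between 2x and 2y, and xy between - (x^2 + y^2) and
  x^2 + y^2. If x is outside \<O>, then \<bar>x\<bar> > 1 and hence \<bar>1/x\<bar> \<le> 1.\<close>

lemma T_convex_ring:
  fixes \<O> :: "'k::linordered_field set"
  assumes "T_convex L (expansion \<F> \<R>) \<O>"
  shows "1 \<in> \<O>" "x \<in> \<O> \<Longrightarrow> - x \<in> \<O>" "x \<in> \<O> \<Longrightarrow> y \<in> \<O> \<Longrightarrow> x + y \<in> \<O>"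
    "x \<in> \<O> \<Longrightarrow> y \<in> \<O> \<Longrightarrow> x * y \<in> \<O>" "x \<notin> \<O> \<Longrightarrow> inverse x \<in> \<O>"
proof -
  have cvx: "y \<in> \<O>" if "x \<in> \<O>" "z \<in> \<O>" "x \<le> y" "y \<le> z" for x y z
    using assms that unfolding T_convex_def by blast
  have cl: "f x \<in> \<O>"
    if "definable_fun L (expansion \<F> \<R>) {} 1 {xs. length xs = 1} (\<lambda>xs. f (hd xs))"
      "continuous1 f" "x \<in> \<O>" for f x
    using assms definable_fun1_UNIV[OF that(1)] that(2,3) unfolding T_convex_def by blast
  obtain p where p: "p \<in> \<O>" using assms by (auto simp: T_convex_def)
  have const: "(\<lambda>_. 1) p \<in> \<O>"
    by (rule cl[OF definable_fun_UNIV[where \<phi> = "Eq (Var 1) One"] _ p])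
       (auto simp: continuous1_def intro: exI[of _ 1])
  then show one: "1 \<in> \<O>" by simp
  have minus: "- x \<in> \<O>" if "x \<in> \<O>" for x
  proof (rule cl[OF definable_fun_UNIV[where \<phi> = "Eq (Add (Var 0) (Var 1)) Zero"] _ that])
    show "continuous1 (uminus :: 'k \<Rightarrow> 'k)"
      unfolding continuous1_def
    proof (intro allI impI)
      fix x \<epsilon> :: 'k assume "0 < \<epsilon>"
      then show "\<exists>\<delta>>0. \<forall>y. \<bar>y - x\<bar> < \<delta> \<longrightarrow> \<bar>- y - - x\<bar> < \<epsilon>"
        by (intro exI[of _ \<epsilon>]) auto
    qed
  qed (auto simp: hd_two eq_neg_iff_add_eq_0 add.commute)
  then show "x \<in> \<O> \<Longrightarrow> - x \<in> \<O>" .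
  have double: "x + x \<in> \<O>" if "x \<in> \<O>" for x
  proof (rule cl[OF definable_fun_UNIV[where \<phi> = "Eq (Var 1) (Add (Var 0) (Var 0))"] _ that])
    show "continuous1 (\<lambda>x :: 'k. x + x)"
      unfolding continuous1_def
    proof (intro allI impI)
      fix x \<epsilon> :: 'k assume "0 < \<epsilon>"
      moreover have "y + y - (x + x) = 2 * (y - x)" for y
        by (simp add: algebra_simps)
      then have "\<bar>y + y - (x + x)\<bar> = 2 * \<bar>y - x\<bar>" for y
        by (simp only: abs_mult abs_numeral)
      ultimately show "\<exists>\<delta>>0. \<forall>y. \<bar>y - x\<bar> < \<delta> \<longrightarrow> \<bar>y + y - (x + x)\<bar> < \<epsilon>"
        by (intro exI[of _ "\<epsilon> / 2"]) (simp only: pos_less_divide_eq zero_less_numeral, simp add: mult.commute)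
    qed
  qed (auto simp: hd_two)
  have square: "x * x \<in> \<O>" if "x \<in> \<O>" for x
  proof (rule cl[OF definable_fun_UNIV[where \<phi> = "Eq (Var 1) (Mul (Var 0) (Var 0))"] _ that])
    show "continuous1 (\<lambda>x :: 'k. x * x)"
      unfolding continuous1_def
    proof (intro allI impI)
      fix x \<epsilon> :: 'k assume \<epsilon>: "0 < \<epsilon>"
      \<comment> \<open>Bounds \<bar>y + x\<bar> as soon as \<bar>y - x\<bar> < 1.\<close>
      define c where "c = 2 * \<bar>x\<bar> + 1"
      have c: "0 < c" unfolding c_def by (intro add_nonneg_pos) auto
      have "\<bar>y * y - x * x\<bar> < \<epsilon>" if y: "\<bar>y - x\<bar> < min 1 (\<epsilon> / c)" for y
      proof -
        have "\<bar>y + x\<bar> \<le> \<bar>y - x\<bar> + 2 * \<bar>x\<bar>" using abs_triangle_ineq[of "y - x" "2 * x"]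
          by (simp add: abs_mult)
        then have "\<bar>y + x\<bar> \<le> c" using y by (simp add: c_def)
        then have "\<bar>y - x\<bar> * \<bar>y + x\<bar> \<le> \<bar>y - x\<bar> * c" by (intro mult_left_mono) auto
        also have "\<dots> < \<epsilon>" using y c by (simp add: field_simps)
        finally have "\<bar>(y - x) * (y + x)\<bar> < \<epsilon>" by (simp only: abs_mult)
        then show ?thesis by (simp only: square_diff_square_factored mult.commute)
      qed
      then show "\<exists>\<delta>>0. \<forall>y. \<bar>y - x\<bar> < \<delta> \<longrightarrow> \<bar>y * y - x * x\<bar> < \<epsilon>"
        using \<epsilon> c by (intro exI[of _ "min 1 (\<epsilon> / c)"]) auto
    qed
  qed (auto simp: hd_two)
  have add: "x + y \<in> \<O>" if "x \<in> \<O>" "y \<in> \<O>" for x y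
    using that cvx[OF double double, of x y "x + y"] cvx[OF double double, of y x "x + y"]
      linear[of x y] by auto
  then show "x \<in> \<O> \<Longrightarrow> y \<in> \<O> \<Longrightarrow> x + y \<in> \<O>" .
  show "x * y \<in> \<O>" if "x \<in> \<O>" "y \<in> \<O>"
  proof (rule cvx)
    show "- (x * x + y * y) \<in> \<O>" "x * x + y * y \<in> \<O>" by (simp_all only: add minus square that)
    have "0 \<le> (x + y) * (x + y)" "0 \<le> (x - y) * (x - y)" by auto
    moreover have "0 \<le> x * x" "0 \<le> y * y" by auto
    ultimately show "- (x * x + y * y) \<le> x * y" "x * y \<le> x * x + y * y"
      by (simp_all add: algebra_simps)
  qed
  show "inverse x \<in> \<O>" if "x \<notin> \<O>"
  proof (rule cvx[OF minus[OF one] one])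
    have "1 < \<bar>x\<bar>"
    proof (rule ccontr)
      assume "\<not> 1 < \<bar>x\<bar>"
      then show False using that cvx[OF minus[OF one] one, of x] by (simp add: abs_le_iff)
    qed
    then have "\<bar>inverse x\<bar> \<le> 1" by (simp add: field_simps)
    then show "- 1 \<le> inverse x" "inverse x \<le> 1" unfolding abs_le_iff by linarith+
  qed
qed

lemma open_set_UNIV: "open_set n {xs. length xs = n}"
  unfolding open_set_def box_def by (auto intro: exI[of _ 1])

lemma length_two_cases: "length xs = 2 \<Longrightarrow> \<exists>x y. xs = [x, y]"
  by (auto simp: numeral_2_eq_2 length_Suc_conv)

text \<open>These are the chain rules for addition and multiplication on K^2. Both are affine in
  each variable, so difference quotients equal the partial derivatives exactly.\<close>

lemma T_derivation_derivation:
  fixes der :: "'k::linordered_field \<Rightarrow> 'k"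
  assumes "T_derivation L (expansion \<F> \<R>) der"
  shows "der (x + y) = der x + der y" "der (x * y) = der x * y + x * der y"
proof -
  let ?U = "{xs :: 'k list. length xs = 2}"
  have T: "der (F [x, y]) = (\<Sum>i<2. G i [x, y] * der ([x, y] ! i))"
    if "definable_fun L (expansion \<F> \<R>) {} 2 ?U F" "C1_fun 2 ?U F G" for F G
    using assms that open_set_UNIV[of 2] unfolding T_derivation_def by force
  have sum2: "(\<Sum>i<2. h i) = h 0 + h (1::nat)" for h :: "nat \<Rightarrow> 'k"
    by (simp add: numeral_2_eq_2)
  have C1: "C1_fun 2 ?U F G"
    if "\<And>x y h. F [x + h, y] - F [x, y] = h * G 0 [x, y]"
      "\<And>x y h. F [x, y + h] - F [x, y] = h * G 1 [x, y]"
      "\<And>i. i < 2 \<Longrightarrow> continuous_fun 2 ?U (G i)" for F and G :: "nat \<Rightarrow> 'k list \<Rightarrow> 'k"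
    unfolding C1_fun_def
  proof (intro allI impI conjI ballI that(3))
    fix i :: nat and u :: "'k list" assume i: "i < 2" and "u \<in> ?U"
    then obtain x y where u: "u = [x, y]" using length_two_cases by blast
    have "i = 0 \<or> i = 1" using i by auto
    then have "F (u[i := u ! i + h]) - F u = h * G i u" for h
      using that(1,2) by (auto simp: u)
    then show "has_partial ?U F i u (G i u)"
      unfolding has_partial_def by (auto intro!: exI[of _ 1])
  qed
  have "der ((\<lambda>xs. xs ! 0 + xs ! 1) [x, y]) = (\<Sum>i<2. (\<lambda>_ _. 1) i [x, y] * der ([x, y] ! i))"
  proof (rule T)
    show "definable_fun L (expansion \<F> \<R>) {} 2 ?U (\<lambda>xs. xs ! 0 + xs ! 1)"
      by (rule definable_fun_UNIV[where \<phi> = "Eq (Var 2) (Add (Var 0) (Var 1))"]) auto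
    show "C1_fun 2 ?U (\<lambda>xs. xs ! 0 + xs ! 1) (\<lambda>_ _. 1)"
      by (rule C1) (auto simp: continuous_fun_def intro: exI[of _ 1])
  qed
  then show "der (x + y) = der x + der y" by (simp add: sum2)
  \<comment> \<open>Each partial derivative of the product is the other coordinate, which has index
    \<open>1 - i\<close>.\<close>
  have "der ((\<lambda>xs. xs ! 0 * xs ! 1) [x, y]) = (\<Sum>i<2. (\<lambda>i xs. xs ! (1 - i)) i [x, y] * der ([x, y] ! i))"
  proof (rule T)
    show "definable_fun L (expansion \<F> \<R>) {} 2 ?U (\<lambda>xs. xs ! 0 * xs ! 1)"
      by (rule definable_fun_UNIV[where \<phi> = "Eq (Var 2) (Mul (Var 0) (Var 1))"]) auto
    show "C1_fun 2 ?U (\<lambda>xs. xs ! 0 * xs ! 1) (\<lambda>i xs. xs ! (1 - i))"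
    proof (rule C1)
      fix i :: nat
      show "continuous_fun 2 ?U (\<lambda>xs. xs ! (1 - i))"
        unfolding continuous_fun_def box_def by (fastforce intro: exI)
    qed (auto simp: algebra_simps)
  qed
  then show "der (x * y) = der x * y + x * der y" by (simp add: sum2 algebra_simps)
qed

lemma models_TO_small_derivation:
  assumes "models_TO L T (expansion \<F> \<R>) \<O> der"
  shows "small_derivation \<O> der"
proof -
  have "T_convex L (expansion \<F> \<R>) \<O>" "T_derivation L (expansion \<F> \<R>) der"
    using assms by (simp_all add: models_TO_def)
  note ring = T_convex_ring[OF this(1)] and der = T_derivation_derivation[OF this(2)]
  show ?thesis
    by unfold_locales (use ring der assms in \<open>auto simp: models_TO_def\<close>)
qed

theorem corollary3p16:
  fixes L :: "('f, 'r) lang" and T :: "('f, 'r) fm set"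
    and \<F> :: "'f \<Rightarrow> 'k::linordered_field list \<Rightarrow> 'k" and \<R> :: "'r \<Rightarrow> 'k list \<Rightarrow> bool"
    and \<O> :: "'k set" and der :: "'k \<Rightarrow> 'k"
  assumes "\<forall>\<sigma>\<in>T. sentence L \<sigma>"
    and "extends_RCF TYPE(('f, 'r, 'k) universe) L T"
    and "complete_theory TYPE(('f, 'r, 'k) universe) L T"
    and "model_complete_theory TYPE(('f, 'r, 'k) universe) L T"
    and "o_minimal_theory TYPE(('f, 'r, 'k) universe) L T"
    and "power_bounded_theory TYPE(('f, 'r, 'k) universe) L T"
    and "models_TO L T (expansion \<F> \<R>) \<O> der"
    and "linearly_surjective (residue_field \<O>) (residue_derivation \<O> der)"
    and "spherically_complete \<O>"
  shows "T_henselian L (expansion \<F> \<R>) \<O> der"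
proof -
  interpret small_derivation \<O> der
    using assms(7) by (rule models_TO_small_derivation)
  have jet_zero: "jet der r 0 = replicate (Suc r) 0" for r
  proof -
    have "(der ^^ i) 0 = 0" for i by (induction i) auto
    then show ?thesis unfolding jet_def by (simp add: map_replicate_const del: upt_Suc)
  qed
  show ?thesis
    unfolding T_henselian_def
  proof (intro conjI allI impI)
    fix r F A
    assume *: "definable_fun L (expansion \<F> \<R>) UNIV (Suc r) {ys. length ys = Suc r} F \<and>
      implicit_form L (expansion \<F> \<R>) r F \<and> A \<noteq> 0 \<and>
      linearly_approximates \<O> der r A F (max_ideal \<O>) \<and>
      vless \<O> (dop_val \<O> A) (val \<O> (F (replicate (Suc r) 0)))"
    \<comment> \<open>The one-variable function R is a -> F(J^r a), with value F(0, ..., 0) at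
      0.\<close>
    have "\<exists>\<epsilon>. \<not> 1 \<preceq> \<epsilon> \<and> F (jet der r \<epsilon>) = 0 \<and> gauss (dop_times der A \<epsilon>) \<preceq> F (jet der r 0)"
    proof (rule linearly_approximated_zero[OF assms(8,9)])
      fix a b assume "a \<prec> 1" "b \<prec> 1" "a \<noteq> b"
      then show "F (jet der r b) - F (jet der r a) - dop_apply der A (b - a)
          \<prec> gauss (dop_times der A (b - a))"
        using * by (simp add: linearly_approximates_def mem_max_ideal_iff dop_val_eq vless_val)
    qed (use * in \<open>auto simp: jet_zero dop_val_eq vless_val\<close>)
    then show "\<exists>\<epsilon>\<in>max_ideal \<O>. F (jet der r \<epsilon>) = 0 \<and>
        vle \<O> (val \<O> (F (replicate (Suc r) 0))) (dop_val \<O> (dop_times der A \<epsilon>))"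
      by (auto simp: mem_max_ideal_iff dop_val_eq vle_val jet_zero)
  qed (rule assms(8))
qed

end
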